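(* Let $-A$ be the generator of a $C_0$-semigroup $(e^{-tA})_{t\ge0}$ on a complex Hilbert space such that $\sigma(A)\cap i\mathbb{R}=\emptyset$. Let $\omega\in\varrho(-A)\cap(0,\infty)$ and assume that $\sup_{n\in\mathbb{N}_0}\|V_\omega(A)^n\|<\infty$. Then the following statements are equivalent for a fixed $\beta\in(0,1]$: (i) $(e^{-tA})_{t\ge0}$ is in the Crandall–Pazy class with parameter $\beta$. (ii) $\|V_\omega(A)^n(\omega+A)^{-1}\|=O(n^{-1/(2-\beta)})$ as $n\to\infty$.
   Context: $\sigma(\cdot)$ and $\varrho(\cdot)$ denote spectrum and resolvent set; $\mathbb{N}_0=\{0,1,2,\dots\}$. For $\omega\in\varrho(-A)\cap(0,\infty)$, $V_\omega(A)=(A-\omega)(A+\omega)^{-1}$ is the Cayley transform. A $C_0$-semigroup $(e^{-tA})_{t\ge0}$ is in the Crandall–Pazy class with parameter $\beta\in(0,1]$ if it is immediately differentiable (i.e., $t\mapsto e^{-tA}x$ is differentiable on $(0,\infty)$ for all $x$) and $\|Ae^{-tA}\|=O(t^{-1/\beta})$ as $t\to0+$. *)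

theory Defs
  imports "HOL-Analysis.Analysis" "HOL-Library.Landau_Symbols"
begin

section \<open>Complex Hilbert spaces\<close>

class complex_vector = real_vector +
  fixes scaleC :: "complex \<Rightarrow> 'a \<Rightarrow> 'a"  (infixr "*\<^sub>C" 75)
  assumes scaleC_add_right: "c *\<^sub>C (x + y) = c *\<^sub>C x + c *\<^sub>C y"
    and scaleC_add_left: "(c + d) *\<^sub>C x = c *\<^sub>C x + d *\<^sub>C x"
    and scaleC_scaleC: "c *\<^sub>C (d *\<^sub>C x) = (c * d) *\<^sub>C x"
    and scaleC_of_real: "complex_of_real r *\<^sub>C x = r *\<^sub>R x"

text \<open>The norm and the completeness come from the class \<open>banach\<close>; the last axiom says that this
  norm is the one induced by the inner product, and so yields positive definiteness.\<close>

class complex_hilbert = complex_vector + banach +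
  fixes cinner :: "'a \<Rightarrow> 'a \<Rightarrow> complex"
  assumes cinner_commute: "cinner y x = cnj (cinner x y)"
    and cinner_add_left: "cinner (x + y) z = cinner x z + cinner y z"
    and cinner_scaleC_left: "cinner (c *\<^sub>C x) y = c * cinner x y"
    and cinner_self: "cinner x x = complex_of_real ((norm x)\<^sup>2)"


section \<open>Unbounded operators\<close>

text \<open>An unbounded operator is given by its domain \<open>D\<close> and a function \<open>A\<close> whose values
  outside \<open>D\<close> are irrelevant. The norm of a bounded operator is \<open>onorm\<close>; for complex-linear maps
  it does not matter that the library regards them as real-linear.\<close>

definition bounded_clinear :: "('a::complex_hilbert \<Rightarrow> 'a) \<Rightarrow> bool" where
  "bounded_clinear f \<longleftrightarrow> bounded_linear f \<and> (\<forall>c x. f (c *\<^sub>C x) = c *\<^sub>C f x)"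

definition resolvent :: "'a::complex_hilbert set \<Rightarrow> ('a \<Rightarrow> 'a) \<Rightarrow> complex \<Rightarrow> 'a \<Rightarrow> 'a" where
  "resolvent D A z = inv_into D (\<lambda>x. z *\<^sub>C x - A x)"

definition resolvent_set :: "'a::complex_hilbert set \<Rightarrow> ('a \<Rightarrow> 'a) \<Rightarrow> complex set" where
  "resolvent_set D A =
     {z. bij_betw (\<lambda>x. z *\<^sub>C x - A x) D UNIV \<and> bounded_clinear (resolvent D A z)}"

definition spectrum :: "'a::complex_hilbert set \<Rightarrow> ('a \<Rightarrow> 'a) \<Rightarrow> complex set" where
  "spectrum D A = - resolvent_set D A"

text \<open>\<open>(A + w)\<^sup>-\<^sup>1\<close> is the resolvent of \<open>- A\<close> at \<open>w\<close>.\<close>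

definition shift_inverse :: "'a::complex_hilbert set \<Rightarrow> ('a \<Rightarrow> 'a) \<Rightarrow> real \<Rightarrow> 'a \<Rightarrow> 'a" where
  "shift_inverse D A w = resolvent D (\<lambda>x. - A x) (complex_of_real w)"

definition cayley :: "'a::complex_hilbert set \<Rightarrow> ('a \<Rightarrow> 'a) \<Rightarrow> real \<Rightarrow> 'a \<Rightarrow> 'a" where
  "cayley D A w x = A (shift_inverse D A w x) - w *\<^sub>R shift_inverse D A w x"


section \<open>Semigroups\<close>

definition C0_semigroup :: "(real \<Rightarrow> 'a::complex_hilbert \<Rightarrow> 'a) \<Rightarrow> bool" where
  "C0_semigroup T \<longleftrightarrow>
     (\<forall>t\<ge>0. bounded_clinear (T t)) \<and>
     T 0 = id \<and>
     (\<forall>s\<ge>0. \<forall>t\<ge>0. T (s + t) = T s \<circ> T t) \<and>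
     (\<forall>x. ((\<lambda>t. T t x) \<longlongrightarrow> x) (at_right 0))"

definition is_generator ::
    "(real \<Rightarrow> 'a::complex_hilbert \<Rightarrow> 'a) \<Rightarrow> 'a set \<Rightarrow> ('a \<Rightarrow> 'a) \<Rightarrow> bool" where
  "is_generator T D B \<longleftrightarrow>
     D = {x. \<exists>y. ((\<lambda>t. (T t x - x) /\<^sub>R t) \<longlongrightarrow> y) (at_right 0)} \<and>
     (\<forall>x\<in>D. ((\<lambda>t. (T t x - x) /\<^sub>R t) \<longlongrightarrow> B x) (at_right 0))"

text \<open>Here \<open>- A\<close> is the generator of \<open>T\<close>. Differentiability of the orbits forces \<open>T t\<close> to map
  into the domain of \<open>A\<close> for \<open>t > 0\<close>, and then \<open>A \<circ> T t\<close> is bounded by the uniform boundedness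
  principle, so that its \<open>onorm\<close> is meaningful.\<close>

definition crandall_pazy ::
    "(real \<Rightarrow> 'a::complex_hilbert \<Rightarrow> 'a) \<Rightarrow> ('a \<Rightarrow> 'a) \<Rightarrow> real \<Rightarrow> bool" where
  "crandall_pazy T A \<beta> \<longleftrightarrow>
     (\<forall>x. \<forall>t>0. (\<lambda>s. T s x) differentiable (at t)) \<and>
     (\<lambda>t. onorm (\<lambda>x. A (T t x))) \<in> O[at_right 0](\<lambda>t. t powr (- 1 / \<beta>))"

end

theory Submission imports Defs "HOL-Computational_Algebra.Polynomial" begin

text \<open>
  Both properties are equivalent to one resolvent estimate: the norm of \<open>(A + \<i>\<eta>)\<^sup>-\<^sup>1\<close> is
  \<open>O(\<bar>\<eta>\<bar> powr (- \<beta>))\<close> as \<open>\<bar>\<eta>\<bar>\<close> tends to infinity (\<open>resolvent_decay\<close>). Write \<open>V\<close> for the Cayley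
  transform and \<open>S\<close> for \<open>(A + w)\<^sup>-\<^sup>1\<close>, where \<open>w\<close> is the parameter of the Cayley transform.

  Since \<open>1 - V = 2 w S\<close>, the second property says that \<open>V\<^sup>n (1 - V)\<close> is \<open>O(n powr (- 1 / \<alpha>))\<close> with
  \<open>\<alpha> = 2 - \<beta>\<close>. For \<open>z \<noteq> 1\<close> on the unit circle, \<open>z - V = (z - 1) (A + \<i>\<eta>) S\<close> with
  \<open>\<i>\<eta> = w (z + 1) / (z - 1)\<close>; hence the resolvent estimate for \<open>A\<close> says that \<open>(z - V)\<^sup>-\<^sup>1\<close> is
  \<open>O(cmod (1 - z) powr (- \<alpha>))\<close> at \<open>z = 1\<close> (\<open>cayley_resolvent_bound\<close>, \<open>resolvent_decay_of_cayley\<close>);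
  away from \<open>1\<close> a bound holds because the spectrum of \<open>A\<close> does not meet the imaginary axis.

  From decay to resolvent estimates (\<open>resolvent_bound_of_decay\<close>, \<open>resolvent_decay_of_crandall_pazy\<close>), an
  approximate eigenvector of the generator or of \<open>V\<close> stays one along its orbit for a time
  inverse to the defect; decay of the orbit thus bounds the defect from below.

  From resolvent estimates to decay, the norm of a Hilbert space is used through Parseval's
  identity. A finite piece of an orbit, multiplied by a cut-off weight, satisfies an inhomogeneous
  difference equation. Under the finite Fourier transform at the roots of \<open>- 1\<close> it becomes a resolvent
  equation at each frequency, in which low frequencies are estimated trivially and high ones by the
  resolvent bound. For \<open>V\<close> this is exact (\<open>decay_of_resolvent_bound\<close>). For the semigroup the orbit is
  sampled (\<open>short_time_estimate\<close>), the derivative is replaced by a central difference, whose Fourier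
  multiplier is imaginary, and the step size tends to \<open>0\<close>; here the resolvent bound is applied
  \<open>m \<ge> 1 / \<beta>\<close> times, each time at the price of one derivative of the weight.
\<close>

section \<open>Complex Hilbert spaces\<close>

lemma norm_scaleC: "norm (c *\<^sub>C (x::'a::complex_hilbert)) = cmod c * norm x"
proof -
  have "complex_of_real ((norm (c *\<^sub>C x))\<^sup>2) = cinner (c *\<^sub>C x) (c *\<^sub>C x)"
    by (simp add: cinner_self)
  also have "\<dots> = c * cnj (cinner (c *\<^sub>C x) x)"
    by (metis cinner_commute cinner_scaleC_left)
  also have "\<dots> = c * cnj c * complex_of_real ((norm x)\<^sup>2)"
    by (simp add: cinner_scaleC_left cinner_self)
  also have "\<dots> = complex_of_real ((cmod c * norm x)\<^sup>2)"
    by (simp add: complex_norm_square[symmetric] power_mult_distrib)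
  finally have "(norm (c *\<^sub>C x))\<^sup>2 = (cmod c * norm x)\<^sup>2"
    using of_real_eq_iff by blast
  then show ?thesis
    by (simp add: power2_eq_iff_nonneg)
qed

lemma scaleC_one [simp]: "1 *\<^sub>C (x::'a::complex_vector) = x"
  using scaleC_of_real[of 1 x] by simp

lemma scaleC_minus_one: "(-1) *\<^sub>C (x::'a::complex_vector) = - x"
  using scaleC_of_real[of "-1" x] by simp

lemma bounded_linear_scaleC: "bounded_linear (\<lambda>x::'a::complex_hilbert. c *\<^sub>C x)"
proof (rule bounded_linear_intro[where K="cmod c"])
  fix r and x :: 'a
  show "c *\<^sub>C (r *\<^sub>R x) = r *\<^sub>R (c *\<^sub>C x)"
    by (simp add: scaleC_of_real[symmetric] scaleC_scaleC mult.commute)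
qed (auto simp: scaleC_add_right norm_scaleC)

lemmas scaleC_zero_right [simp] = linear_0[OF bounded_linear.linear[OF bounded_linear_scaleC]]
lemmas scaleC_minus_right = linear_neg[OF bounded_linear.linear[OF bounded_linear_scaleC]]
lemmas scaleC_diff_right = linear_diff[OF bounded_linear.linear[OF bounded_linear_scaleC]]
lemmas scaleC_sum_right = linear_sum[OF bounded_linear.linear[OF bounded_linear_scaleC]]
lemmas scaleC_scaleR_right = linear_scale[OF bounded_linear.linear[OF bounded_linear_scaleC]]

lemma scaleC_minus_left: "(- c) *\<^sub>C (x::'a::complex_hilbert) = - (c *\<^sub>C x)"
  by (metis mult_minus1 scaleC_minus_one scaleC_scaleC)

lemma scaleC_diff_left: "(c - d) *\<^sub>C (x::'a::complex_hilbert) = c *\<^sub>C x - d *\<^sub>C x"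
  by (metis diff_conv_add_uminus scaleC_add_left scaleC_minus_left)

lemma cinner_zero_left [simp]: "cinner 0 (y::'a::complex_hilbert) = 0"
  using cinner_add_left[of 0 0 y] by simp

lemma cinner_sum_left: "cinner (\<Sum>i\<in>I. f i) (y::'a::complex_hilbert) = (\<Sum>i\<in>I. cinner (f i) y)"
  by (induction I rule: infinite_finite_induct) (auto simp: cinner_add_left)

lemma cinner_sum_right: "cinner (y::'a::complex_hilbert) (\<Sum>i\<in>I. f i) = (\<Sum>i\<in>I. cinner y (f i))"
  by (subst cinner_commute) (simp add: cinner_sum_left flip: cinner_commute)

lemma cinner_scaleC_right: "cinner (x::'a::complex_hilbert) (c *\<^sub>C y) = cnj c * cinner x y"
  by (metis cinner_commute cinner_scaleC_left complex_cnj_mult)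

section \<open>The finite Fourier transform\<close>

text \<open>The \<open>N\<close>-th roots of \<open>- 1\<close>. Sampling there instead of at the roots of unity avoids the point \<open>1\<close>,
  at which nothing is known about the resolvent of \<open>V\<close>, and, for even \<open>N\<close>, avoids the real
  points, which correspond to the frequency \<open>0\<close> of the semigroup.\<close>

definition node :: "nat \<Rightarrow> nat \<Rightarrow> complex" where
  "node N j = cis (pi * (2 * real j + 1) / real N)"

text \<open>The discrete Fourier transform of the finite sequence \<open>g 0, \<dots>, g (N - 1)\<close> at the point
  \<open>z\<close> of the unit circle.\<close>

definition dft :: "nat \<Rightarrow> (nat \<Rightarrow> 'a::complex_hilbert) \<Rightarrow> complex \<Rightarrow> 'a" where
  "dft N g z = (\<Sum>k<N. cnj z ^ k *\<^sub>C g k)"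

lemma norm_node [simp]: "cmod (node N j) = 1"
  by (simp add: node_def)

lemma sum_node_powers:
  assumes k: "k < N" and l: "l < N"
  shows "(\<Sum>j<N. cnj (node N j) ^ k * node N j ^ l) = (if k = l then of_nat N else 0)"
proof (cases "k = l")
  case True
  have "cnj (node N j) ^ k * node N j ^ k = 1" for j
    by (metis complex_norm_square mult.commute norm_node of_real_1 power_mult_distrib power_one)
  then show ?thesis using True by simp
next
  case False
  have N: "N > 0" using k by simp
  define a where "a = 2 * pi * (real l - real k) / real N"
  define q where "q = cis a"
  have tm: "cnj (node N j) ^ k * node N j ^ l = cis (a/2) * q ^ j" for j
  proof -
    have "cnj (node N j) ^ k * node N j ^ l = cis (pi * (2 * real j + 1) / real N * (real l - real k))"
      by (simp add: node_def cis_cnj Complex.DeMoivre cis_mult algebra_simps diff_divide_distrib)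
    also have "pi * (2 * real j + 1) / real N * (real l - real k) = a/2 + real j * a"
      using N by (simp add: a_def field_simps)
    also have "cis (a/2 + real j * a) = cis (a/2) * q ^ j"
      by (simp add: q_def Complex.DeMoivre cis_mult)
    finally show ?thesis .
  qed
  \<comment> \<open>\<open>q\<close> is an \<open>N\<close>-th root of unity, and it is not \<open>1\<close> because \<open>0 < \<bar>l - k\<bar> < N\<close>.\<close>
  have q1: "q \<noteq> 1"
  proof
    assume "q = 1"
    then have "cos a = 1" by (metis cis.simps(1) one_complex.simps(1) q_def)
    then obtain m :: int where m: "a = of_int m * 2 * pi"
      by (auto simp: cos_one_2pi_int)
    then have "2 * pi * ((real l - real k) / real N) = 2 * pi * of_int m"
      by (simp add: a_def)
    then have "(real l - real k) / real N = of_int m"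
      using pi_gt_zero by (subst (asm) mult_left_cancel) auto
    then have "real l - real k = of_int m * real N"
      using N by (simp add: field_simps)
    then have "real_of_int (int l - int k) = of_int (m * int N)" by simp
    then have *: "int l - int k = m * int N" by (simp only: of_int_eq_iff)
    have "\<bar>int l - int k\<bar> < int N" using k l by linarith
    then have "\<bar>m\<bar> * int N < 1 * int N" using * N by (simp add: abs_mult)
    then have "m = 0" using N by (simp add: mult_less_cancel_right)
    then show False using * False by simp
  qed
  have "q ^ N = cis (2 * pi * (real l - real k))"
    using N by (simp add: q_def Complex.DeMoivre a_def)
  also have "\<dots> = cis (2 * pi * real l) / cis (2 * pi * real k)"
    by (simp add: cis_divide algebra_simps)
  also have "\<dots> = 1"
    by (simp add: cis_multiple_2pi)
  finally have "(\<Sum>j<N. q ^ j) = 0" using q1 by (simp add: sum_gp_strict)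
  then have "(\<Sum>j<N. cis (a/2) * q ^ j) = 0"
    by (simp add: sum_distrib_left[symmetric])
  then show ?thesis using False by (simp add: tm)
qed

lemma parseval:
  fixes g :: "nat \<Rightarrow> 'a::complex_hilbert"
  shows "(\<Sum>j<N. (norm (dft N g (node N j)))\<^sup>2) = real N * (\<Sum>k<N. (norm (g k))\<^sup>2)"
proof -
  have "complex_of_real (\<Sum>j<N. (norm (dft N g (node N j)))\<^sup>2) =
      (\<Sum>j<N. \<Sum>k<N. \<Sum>l<N. cnj (node N j) ^ k * node N j ^ l * cinner (g k) (g l))"
    unfolding of_real_sum cinner_self[symmetric] dft_def
    by (subst cinner_sum_left, subst cinner_sum_right)
      (simp add: cinner_scaleC_left cinner_scaleC_right sum_distrib_left mult.assoc mult.left_commute)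
  also have "\<dots> = (\<Sum>k<N. \<Sum>j<N. \<Sum>l<N. cnj (node N j) ^ k * node N j ^ l * cinner (g k) (g l))"
    by (rule sum.swap)
  also have "\<dots> = (\<Sum>k<N. \<Sum>l<N. \<Sum>j<N. cnj (node N j) ^ k * node N j ^ l * cinner (g k) (g l))"
    by (intro sum.cong refl sum.swap)
  also have "\<dots> = (\<Sum>k<N. \<Sum>l<N. (if k = l then of_nat N else 0) * cinner (g k) (g l))"
    by (intro sum.cong refl) (simp add: sum_distrib_right[symmetric] sum_node_powers)
  also have "\<dots> = (\<Sum>k<N. of_nat N * cinner (g k) (g k))"
    by (intro sum.cong refl) (simp add: if_distrib[of "\<lambda>c. c * _"] cong: if_cong)
  also have "\<dots> = complex_of_real (real N * (\<Sum>k<N. (norm (g k))\<^sup>2))"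
    by (simp add: cinner_self sum_distrib_left)
  finally show ?thesis
    using of_real_eq_iff by blast
qed

lemma node_power: "N > 0 \<Longrightarrow> node N j ^ N = - 1"
proof -
  assume "N > 0"
  then have "real N * (pi * (2 * real j + 1) / real N) = pi + 2 * pi * real j"
    by (simp add: field_simps)
  then have "node N j ^ N = cis (pi + 2 * pi * real j)"
    by (simp add: node_def Complex.DeMoivre)
  also have "\<dots> = cis pi * cis (2 * pi * real j)"
    by (simp only: cis_mult)
  also have "\<dots> = - 1"
    by (simp add: cis_multiple_2pi)
  finally show ?thesis .
qed

lemma node_neq_1: "N > 0 \<Longrightarrow> node N j \<noteq> 1"
  using node_power[of N j] by auto

text \<open>From \<open>z ^ N = - 1\<close> with \<open>N\<close> even one gets \<open>2 = cmod (1 - (z\<^sup>2) ^ (N div 2)) \<le> N / 2 * cmod (1 - z\<^sup>2)\<close>.\<close>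

lemma abs_Im_node:
  assumes "even N" "N > 0"
  shows "\<bar>Im (node N j)\<bar> \<ge> 2 / real N"
proof -
  define z where "z = node N j"
  obtain m where m: "N = 2 * m" using assms(1) by blast
  have m0: "m > 0" using m assms(2) by simp
  have cz: "cmod z = 1" by (simp add: z_def)
  have "(z\<^sup>2) ^ m = - 1"
    using node_power[OF assms(2), of j] by (simp add: z_def m power_mult)
  then have "2 = cmod ((z\<^sup>2) ^ m - 1 ^ m)" by simp
  also have "\<dots> \<le> real m * cmod (z\<^sup>2 - 1)"
    by (rule norm_power_diff) (simp_all add: norm_power cz)
  also have "z\<^sup>2 - 1 = z * (z - cnj z)"
    using complex_norm_square[of z] cz by (simp add: power2_eq_square algebra_simps)
  also have "cmod (z * (z - cnj z)) = 2 * \<bar>Im z\<bar>"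
    using cz by (simp add: norm_mult complex_diff_cnj)
  finally show ?thesis using m m0 by (simp add: z_def field_simps)
qed

lemma dft_diff: "dft N (\<lambda>k. f k - g k) z = dft N f z - dft N g z"
  by (simp add: dft_def scaleC_diff_right sum_subtractf)

lemma dft_scaleR: "dft N (\<lambda>k. r *\<^sub>R g k) z = r *\<^sub>R dft N g z"
  by (simp add: dft_def scaleC_scaleR_right scaleR_sum_right)

lemma dft_shift:
  assumes z: "cmod z = 1" and g: "g 0 = 0" "g N = 0"
  shows "dft N (\<lambda>k. g (Suc k)) z = z *\<^sub>C dft N g z"
proof -
  have zz: "z * cnj z = 1" using z complex_norm_square[of z] by simp
  have "dft N (\<lambda>k. g (Suc k)) z = (\<Sum>k<N. z *\<^sub>C (cnj z ^ Suc k *\<^sub>C g (Suc k)))"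
    unfolding dft_def by (intro sum.cong refl) (simp add: scaleC_scaleC zz flip: mult.assoc)
  also have "\<dots> = z *\<^sub>C (\<Sum>k<N. cnj z ^ Suc k *\<^sub>C g (Suc k))"
    by (rule scaleC_sum_right[symmetric])
  also have "(\<Sum>k<N. cnj z ^ Suc k *\<^sub>C g (Suc k)) = (\<Sum>k<Suc N. cnj z ^ k *\<^sub>C g k)"
    by (subst sum.lessThan_Suc_shift) (simp add: g)
  also have "\<dots> = dft N g z" by (simp add: dft_def g)
  finally show ?thesis .
qed

text \<open>A bound between Fourier transforms at the nodes gives a mean square bound between sequences.\<close>

lemma dft_comparison:
  assumes I: "finite I"
    and le: "\<And>j. j < N \<Longrightarrow> norm (dft N a (node N j)) \<le> (\<Sum>i\<in>I. c i * norm (dft N (b i) (node N j)))"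
  shows "(\<Sum>k<N. (norm (a k))\<^sup>2) \<le> real (card I) * (\<Sum>i\<in>I. (c i)\<^sup>2 * (\<Sum>k<N. (norm (b i k))\<^sup>2))"
proof (cases "N = 0")
  case False
  have "real N * (\<Sum>k<N. (norm (a k))\<^sup>2) = (\<Sum>j<N. (norm (dft N a (node N j)))\<^sup>2)"
    by (rule parseval[symmetric])
  also have "\<dots> \<le> (\<Sum>j<N. real (card I) * (\<Sum>i\<in>I. (c i)\<^sup>2 * (norm (dft N (b i) (node N j)))\<^sup>2))"
  proof (rule sum_mono)
    fix j assume "j \<in> {..<N}"
    then have "(norm (dft N a (node N j)))\<^sup>2 \<le> (\<Sum>i\<in>I. c i * norm (dft N (b i) (node N j)))\<^sup>2"
      by (intro power_mono le) auto
    also have "\<dots> \<le> (\<Sum>i\<in>I. (c i * norm (dft N (b i) (node N j)))\<^sup>2) * real (card I)"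
      by (rule sum_squared_le_sum_of_squares)
    finally show "(norm (dft N a (node N j)))\<^sup>2
        \<le> real (card I) * (\<Sum>i\<in>I. (c i)\<^sup>2 * (norm (dft N (b i) (node N j)))\<^sup>2)"
      by (simp add: power_mult_distrib mult.commute)
  qed
  also have "\<dots> = real (card I) * (\<Sum>i\<in>I. (c i)\<^sup>2 * (\<Sum>j<N. (norm (dft N (b i) (node N j)))\<^sup>2))"
    by (simp add: sum_distrib_left[symmetric]) (simp add: sum_distrib_left sum.swap[of _ I])
  also have "\<dots> = real N * (real (card I) * (\<Sum>i\<in>I. (c i)\<^sup>2 * (\<Sum>k<N. (norm (b i k))\<^sup>2)))"
    by (simp add: parseval sum_distrib_left mult_ac)
  finally show ?thesis using False by simp
qed simp

section \<open>Bounded linear maps\<close>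

lemma bounded_linear_funpow:
  fixes f :: "'a::real_normed_vector \<Rightarrow> 'a"
  assumes "bounded_linear f"
  shows "bounded_linear (f ^^ n)"
proof (induction n)
  case (Suc n)
  then show ?case using bounded_linear_compose[OF assms] by (simp add: o_def)
qed (simp add: id_def bounded_linear_ident)

text \<open>The uniform boundedness principle, for families that are only pointwise bounded on an
  index set.\<close>

lemma uniform_boundedness:
  fixes f :: "'i \<Rightarrow> 'a::banach \<Rightarrow> 'b::real_normed_vector"
  assumes bl: "\<And>i. i \<in> I \<Longrightarrow> bounded_linear (f i)"
    and bd: "\<And>x. \<exists>B. \<forall>i\<in>I. norm (f i x) \<le> B"
  shows "\<exists>B>0. \<forall>i\<in>I. \<forall>x. norm (f i x) \<le> B * norm x"
proof -
  define G where "G = (\<lambda>k::nat. {x. \<exists>i\<in>I. norm (f i x) > real k})"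
  have openG: "open (G k)" for k
  proof -
    have "G k = (\<Union>i\<in>I. {x. real k < norm (f i x)})" by (auto simp: G_def)
    moreover have "open {x. real k < norm (f i x)}" if "i \<in> I" for i
      using bl[OF that] by (intro open_Collect_less continuous_intros linear_continuous_on) auto
    ultimately show ?thesis by auto
  qed
  \<comment> \<open>By Baire's theorem the open sets \<open>G k\<close>, whose intersection is empty, are not all dense.\<close>
  have "\<exists>k. \<not> UNIV \<subseteq> closure (G k)"
  proof (rule ccontr)
    assume "\<nexists>k. \<not> UNIV \<subseteq> closure (G k)"
    then have "closure (G k) = UNIV" for k by blast
    then have "Met_TC.mtopology closure_of (\<Inter>(range G)) = UNIV"
      using openG by (intro Met_TC.metric_Baire_category)
        (auto simp: complete_UNIV)
    then have "closure (\<Inter>(range G)) = UNIV" by simp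
    then obtain x where x: "x \<in> \<Inter>(range G)"
      by (metis closure_empty ex_in_conv UNIV_not_empty)
    obtain B where B: "\<forall>i\<in>I. norm (f i x) \<le> B" using bd by blast
    obtain k :: nat where "B \<le> real k" using real_arch_simple by blast
    moreover obtain i where "i \<in> I" "real k < norm (f i x)" using x by (auto simp: G_def)
    ultimately show False using B by fastforce
  qed
  then obtain k a where a: "a \<notin> closure (G k)" by blast
  then obtain r where r: "r > 0" "\<And>y. dist y a < r \<Longrightarrow> y \<notin> G k"
    by (metis closure_approachable)
  have "norm (f i x) \<le> (4 * (real k + 1) / r) * norm x" if i: "i \<in> I" for i x
  proof (cases "x = 0")
    case True
    then show ?thesis using linear_0[OF bounded_linear.linear[OF bl[OF i]]] by simp
  next
    case False
    define c where "c = r / (2 * norm x)"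
    have c: "c > 0" using False r by (simp add: c_def)
    interpret bounded_linear "f i" by (rule bl[OF i])
    have "dist (a + c *\<^sub>R x) a < r"
      using False r c by (simp add: dist_norm c_def)
    then have 1: "norm (f i (a + c *\<^sub>R x)) \<le> real k" using r(2) i by (force simp: G_def)
    have 2: "norm (f i a) \<le> real k" using r(2)[of a] r(1) i by (force simp: G_def)
    have "c *\<^sub>R f i x = f i (a + c *\<^sub>R x) - f i a" by (simp add: add scaleR)
    then have "c * norm (f i x) \<le> 2 * real k"
      using norm_triangle_ineq4[of "f i (a + c *\<^sub>R x)" "f i a"] 1 2 c
      by (metis (no_types, opaque_lifting) abs_of_pos add_mono mult_2 norm_scaleR order_trans)
    then have "norm (f i x) \<le> 2 * real k / c" using c by (simp add: field_simps)
    also have "\<dots> = 4 * real k / r * norm x" using False r by (simp add: c_def)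
    also have "\<dots> \<le> (4 * (real k + 1) / r) * norm x"
      using r by (intro mult_right_mono divide_right_mono) auto
    finally show ?thesis .
  qed
  then show ?thesis using r(1)
    by (intro exI[of _ "4 * (real k + 1) / r"]) auto
qed

section \<open>Semigroups and their generators\<close>

lemma has_vector_derivative_iff_quotient:
  "(f has_vector_derivative y) (at t within S) \<longleftrightarrow>
    ((\<lambda>s. (f s - f t) /\<^sub>R (s - t)) \<longlongrightarrow> y) (at t within S)"
proof -
  have "norm (f s - f t - (s - t) *\<^sub>R y) / norm (s - t) = norm ((f s - f t) /\<^sub>R (s - t) - y)"
    if "s \<noteq> t" for s
  proof -
    have "(f s - f t) /\<^sub>R (s - t) - y = (f s - f t - (s - t) *\<^sub>R y) /\<^sub>R (s - t)"
      using that by (simp add: scaleR_diff_right)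
    then show ?thesis by (simp add: divide_inverse_commute)
  qed
  then have "((\<lambda>s. norm (f s - f t - (s - t) *\<^sub>R y) / norm (s - t)) \<longlongrightarrow> 0) (at t within S) \<longleftrightarrow>
      ((\<lambda>s. norm ((f s - f t) /\<^sub>R (s - t) - y)) \<longlongrightarrow> 0) (at t within S)"
    by (intro filterlim_cong refl) (auto simp: eventually_at intro!: exI[of _ 1])
  then show ?thesis
    by (simp add: has_vector_derivative_def has_derivative_iff_norm bounded_linear_scaleR_left
      tendsto_norm_zero_iff LIM_zero_iff)
qed

text \<open>A \<open>C\<^sub>0\<close>-semigroup \<open>T\<close> with generator \<open>- A\<close>, whose domain is \<open>D\<close>.\<close>

locale semigroup_generator =
  fixes T :: "real \<Rightarrow> 'a::complex_hilbert \<Rightarrow> 'a" and D :: "'a set" and A :: "'a \<Rightarrow> 'a"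
  assumes semigroup: "C0_semigroup T"
    and generator: "is_generator T D (\<lambda>x. - A x)"
begin

lemma T_bounded_linear: "t \<ge> 0 \<Longrightarrow> bounded_linear (T t)"
  using semigroup by (auto simp: C0_semigroup_def bounded_clinear_def)

lemma T_scaleC: "t \<ge> 0 \<Longrightarrow> T t (c *\<^sub>C x) = c *\<^sub>C T t x"
  using semigroup by (auto simp: C0_semigroup_def bounded_clinear_def)

lemma T_zero [simp]: "T 0 x = x"
  using semigroup by (auto simp: C0_semigroup_def)

lemma T_add: "s \<ge> 0 \<Longrightarrow> t \<ge> 0 \<Longrightarrow> T (s + t) x = T s (T t x)"
  using semigroup by (auto simp: C0_semigroup_def)

lemma T_commute: "s \<ge> 0 \<Longrightarrow> t \<ge> 0 \<Longrightarrow> T s (T t x) = T t (T s x)"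
  by (metis T_add add.commute)

lemma T_tendsto_0: "((\<lambda>t. T t x) \<longlongrightarrow> x) (at_right 0)"
  using semigroup by (auto simp: C0_semigroup_def)

lemmas T_diff = linear_diff[OF bounded_linear.linear[OF T_bounded_linear]]
lemmas T_plus = linear_add[OF bounded_linear.linear[OF T_bounded_linear]]
lemmas T_minus = linear_neg[OF bounded_linear.linear[OF T_bounded_linear]]
lemmas T_scaleR = linear_scale[OF bounded_linear.linear[OF T_bounded_linear]]
lemmas T_0 = linear_0[OF bounded_linear.linear[OF T_bounded_linear]]

lemma D_I: "((\<lambda>t. (T t x - x) /\<^sub>R t) \<longlongrightarrow> y) (at_right 0) \<Longrightarrow> x \<in> D"
  using generator by (auto simp: is_generator_def)

lemma D_tendsto: "x \<in> D \<Longrightarrow> ((\<lambda>t. (T t x - x) /\<^sub>R t) \<longlongrightarrow> - A x) (at_right 0)"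
  using generator by (auto simp: is_generator_def)

lemma A_eqI:
  assumes "((\<lambda>t. (T t x - x) /\<^sub>R t) \<longlongrightarrow> y) (at_right 0)"
  shows "A x = - y"
  using tendsto_unique[OF _ D_tendsto[OF D_I[OF assms]] assms] by auto

text \<open>Otherwise the norms of some operators \<open>T (t n)\<close> with \<open>t n\<close> tending to \<open>0\<close> would be unbounded,
  although all the sequences \<open>T (t n) x\<close> converge.\<close>

lemma T_bound_near_0: "\<exists>\<delta>>0. \<exists>B\<ge>1. \<forall>t\<in>{0..\<delta>}. \<forall>x. norm (T t x) \<le> B * norm x"
proof (rule ccontr)
  assume neg: "\<not> ?thesis"
  have "\<exists>t\<in>{0..1 / (real n + 1)}. \<exists>x. norm (T t x) > (real n + 1) * norm x" for n :: nat
  proof (rule ccontr)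
    assume "\<not> (\<exists>t\<in>{0..1 / (real n + 1)}. \<exists>x. norm (T t x) > (real n + 1) * norm x)"
    then have "\<exists>\<delta>>0. \<exists>B\<ge>1. \<forall>t\<in>{0..\<delta>}. \<forall>x. norm (T t x) \<le> B * norm x"
      by (intro exI[of _ "1 / (real n + 1)"] conjI exI[of _ "real n + 1"]) (auto simp: not_less)
    with neg show False by blast
  qed
  then obtain t where t: "\<And>n::nat. t n \<in> {0..1 / (real n + 1)}"
      "\<And>n. \<exists>x. norm (T (t n) x) > (real n + 1) * norm x" by metis
  have t0: "t n > 0" for n
  proof (rule ccontr)
    assume "\<not> t n > 0"
    then have "t n = 0" using t(1)[of n] by auto
    then obtain x :: 'a where "norm x > (real n + 1) * norm x" using t(2)[of n] by auto
    then show False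
      using mult_right_mono[of 1 "real n + 1" "norm x"] by simp
  qed
  have "t \<longlonglongrightarrow> 0"
  proof (rule tendsto_sandwich[of "\<lambda>_. 0" _ _ "\<lambda>n. 1 / (real n + 1)"])
    show "(\<lambda>n. 1 / (real n + 1)) \<longlonglongrightarrow> 0"
      using LIMSEQ_inverse_real_of_nat by (simp add: inverse_eq_divide add.commute)
  qed (use t(1) in auto)
  then have flim: "filterlim t (at_right 0) sequentially"
    using t0 less_imp_neq[OF t0] by (auto simp: filterlim_at intro!: always_eventually)
  have "\<exists>B>0. \<forall>n\<in>UNIV. \<forall>x. norm (T (t n) x) \<le> B * norm x"
  proof (rule uniform_boundedness)
    fix n show "bounded_linear (T (t n))" using t0[of n] by (intro T_bounded_linear) auto
  next
    fix x
    have "(\<lambda>n. T (t n) x) \<longlonglongrightarrow> x"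
      using filterlim_compose[OF T_tendsto_0 flim] .
    then have "Bseq (\<lambda>n. T (t n) x)" by (intro convergent_imp_Bseq convergentI)
    then show "\<exists>B. \<forall>n\<in>UNIV. norm (T (t n) x) \<le> B" by (auto simp: Bseq_def)
  qed
  then obtain B where B: "\<And>n x. norm (T (t n) x) \<le> B * norm x" by blast
  obtain n :: nat where n: "B \<le> real n" using real_arch_simple by blast
  obtain x where x: "norm (T (t n) x) > (real n + 1) * norm x" using t(2) by blast
  have "B * norm x \<le> (real n + 1) * norm x" using n by (intro mult_right_mono) auto
  with x B[of n x] show False by simp
qed

lemma T_locally_bounded: "\<exists>M\<ge>1. \<forall>t\<in>{0..a}. \<forall>x. norm (T t x) \<le> M * norm x"
proof -
  obtain \<delta> B where d: "\<delta> > 0" and B: "B \<ge> 1"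
      and bd: "\<And>t x. 0 \<le> t \<Longrightarrow> t \<le> \<delta> \<Longrightarrow> norm (T t x) \<le> B * norm x"
    using T_bound_near_0 by (metis atLeastAtMost_iff)
  have *: "norm (T t x) \<le> B ^ Suc k * norm x" if "0 \<le> t" "t \<le> real (Suc k) * \<delta>" for t k x
    using that
  proof (induction k arbitrary: t)
    case 0
    then show ?case using bd by simp
  next
    case (Suc k)
    define s where "s = max 0 (t - \<delta>)"
    have s: "0 \<le> s" "s \<le> real (Suc k) * \<delta>" "0 \<le> t - s" "t - s \<le> \<delta>"
      using Suc.prems d by (auto simp: s_def algebra_simps max_def)
    have "norm (T t x) = norm (T (t - s) (T s x))" using s by (simp flip: T_add)
    also have "\<dots> \<le> B * norm (T s x)" using bd s by blast
    also have "\<dots> \<le> B * (B ^ Suc k * norm x)"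
      using Suc.IH[of s] s B by (intro mult_left_mono) auto
    finally show ?case by (simp add: mult.assoc)
  qed
  obtain k :: nat where k: "a / \<delta> \<le> real k" using real_arch_simple by blast
  have "norm (T t x) \<le> B ^ Suc k * norm x" if "t \<in> {0..a}" for t x
  proof (rule *)
    have "a \<le> real k * \<delta>" using k d by (simp add: field_simps)
    also have "\<dots> \<le> real (Suc k) * \<delta>" using d by simp
    finally show "t \<le> real (Suc k) * \<delta>" using that by simp
  qed (use that in auto)
  moreover have "B ^ Suc k \<ge> 1" using B by (rule one_le_power)
  ultimately show ?thesis by blast
qed

lemma T_continuous: "continuous_on {0..} (\<lambda>t. T t x)"
  unfolding continuous_on_def
proof
  fix t :: real assume "t \<in> {0..}"
  then have t: "t \<ge> 0" by simp
  obtain M where M: "M \<ge> 1" "\<And>s x. 0 \<le> s \<Longrightarrow> s \<le> t + 1 \<Longrightarrow> norm (T s x) \<le> M * norm x"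
    using T_locally_bounded[of "t + 1"] by (metis atLeastAtMost_iff)
  show "((\<lambda>t. T t x) \<longlongrightarrow> T t x) (at t within {0..})"
  proof (rule tendstoI)
    fix e :: real assume e: "e > 0"
    have "eventually (\<lambda>h. dist (T h x) x < e / M) (at_right 0)"
      using e M(1) by (intro tendstoD[OF T_tendsto_0]) auto
    then obtain d where d: "d > 0" "\<And>h. 0 < h \<Longrightarrow> h < d \<Longrightarrow> dist (T h x) x < e / M"
      by (auto simp: eventually_at_right_field)
    have "dist (T s x) (T t x) < e" if s: "s \<ge> 0" "s \<noteq> t" "dist s t < min d 1" for s
    proof -
      define h where "h = \<bar>s - t\<bar>"
      have h: "0 < h" "h < d" "h < 1" using s by (auto simp: h_def dist_real_def)
      have "dist (T s x) (T t x) = norm (T (min s t) (T h x - x))"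
      proof (cases "s < t")
        case True
        then have "t = s + h" "min s t = s" by (auto simp: h_def)
        then show ?thesis using s h by (simp add: dist_norm T_add T_diff norm_minus_commute)
      next
        case False
        then have "s = t + h" "min s t = t" by (auto simp: h_def)
        then show ?thesis using t h by (simp add: dist_norm T_add T_diff)
      qed
      also have "\<dots> \<le> M * norm (T h x - x)" using M(2) s t by auto
      also have "\<dots> < M * (e / M)"
        using d(2)[OF h(1,2)] M(1) by (intro mult_strict_left_mono) (auto simp: dist_norm)
      finally show ?thesis using M(1) by simp
    qed
    then show "eventually (\<lambda>s. dist (T s x) (T t x) < e) (at t within {0..})"
      using d(1) by (auto simp: eventually_at intro!: exI[of _ "min d 1"])
  qed
qed

lemma T_D:
  assumes "x \<in> D" "t \<ge> 0"
  shows "T t x \<in> D" and "A (T t x) = T t (A x)"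
proof -
  have "((\<lambda>h. T t ((T h x - x) /\<^sub>R h)) \<longlongrightarrow> T t (- A x)) (at_right 0)"
    by (rule bounded_linear.tendsto[OF T_bounded_linear[OF assms(2)] D_tendsto[OF assms(1)]])
  moreover have "eventually (\<lambda>h. T t ((T h x - x) /\<^sub>R h) = (T h (T t x) - T t x) /\<^sub>R h) (at_right 0)"
    using eventually_at_right_less[of 0]
  proof eventually_elim
    case (elim h)
    then have "T t (T h x) = T h (T t x)" using assms(2) by (intro T_commute) auto
    then show ?case using assms(2) by (simp only: T_scaleR T_diff)
  qed
  ultimately have *: "((\<lambda>h. (T h (T t x) - T t x) /\<^sub>R h) \<longlongrightarrow> T t (- A x)) (at_right 0)"
    by (rule Lim_transform_eventually)
  show "T t x \<in> D" using D_I[OF *] .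
  show "A (T t x) = T t (A x)" using A_eqI[OF *] assms by (simp add: T_minus)
qed

text \<open>With \<open>h = \<bar>s - t\<bar>\<close>, the difference quotient of the orbit between \<open>s\<close> and \<open>t\<close> is the value of
  \<open>T (min s t)\<close> at \<open>(T h x - x) / h\<close>, on both sides of \<open>t\<close>.\<close>

lemma T_has_derivative:
  assumes x: "x \<in> D" and t: "t > 0"
  shows "((\<lambda>s. T s x) has_vector_derivative - T t (A x)) (at t)"
proof -
  obtain M where M: "M \<ge> 1" "\<And>s x. 0 \<le> s \<Longrightarrow> s \<le> t \<Longrightarrow> norm (T s x) \<le> M * norm x"
    using T_locally_bounded[of t] by (metis atLeastAtMost_iff)
  define q where "q = (\<lambda>h. (T h x - x) /\<^sub>R h)"
  have q: "(q \<longlongrightarrow> - A x) (at_right 0)" unfolding q_def by (rule D_tendsto[OF x])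
  have abs: "filterlim (\<lambda>s. \<bar>s - t\<bar>) (at_right 0) (at t)"
  proof -
    have "((\<lambda>s. \<bar>s - t\<bar>) \<longlongrightarrow> \<bar>t - t\<bar>) (at t)" by (intro tendsto_intros)
    then show ?thesis by (auto simp: filterlim_at eventually_at intro!: exI[of _ 1])
  qed
  have 1: "((\<lambda>s. M * norm (q \<bar>s - t\<bar> + A x)) \<longlongrightarrow> M * norm (- A x + A x)) (at t)"
    by (intro tendsto_intros filterlim_compose[OF q abs])
  have "continuous_on {0..} (\<lambda>s. T s (A x))" by (rule T_continuous)
  then have "isCont (\<lambda>s. T s (A x)) t"
    using t by (intro continuous_on_interior[of "{0..}"]) auto
  moreover have "((\<lambda>s. min s t) \<longlongrightarrow> min t t) (at t)" by (intro tendsto_intros)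
  ultimately have 2: "((\<lambda>s. T (min s t) (A x)) \<longlongrightarrow> T t (A x)) (at t)"
    using isCont_tendsto_compose by fastforce
  have "((\<lambda>s. M * norm (q \<bar>s - t\<bar> + A x) + norm (T (min s t) (A x) - T t (A x)))
      \<longlongrightarrow> M * norm (- A x + A x) + norm (T t (A x) - T t (A x))) (at t)"
    by (intro tendsto_intros 1 2)
  then have lim0: "((\<lambda>s. M * norm (q \<bar>s - t\<bar> + A x) + norm (T (min s t) (A x) - T t (A x))) \<longlongrightarrow> 0) (at t)"
    by simp
  have "((\<lambda>s. (T s x - T t x) /\<^sub>R (s - t) - (- T t (A x))) \<longlongrightarrow> 0) (at t)"
  proof (rule Lim_null_comparison[OF _ lim0])
    have "norm ((T s x - T t x) /\<^sub>R (s - t) - (- T t (A x)))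
        \<le> M * norm (q \<bar>s - t\<bar> + A x) + norm (T (min s t) (A x) - T t (A x))"
      if s: "s > 0" "s \<noteq> t" for s
    proof -
      define h where "h = \<bar>s - t\<bar>"
      have h: "h > 0" using s by (simp add: h_def)
      have eq: "(T s x - T t x) /\<^sub>R (s - t) = T (min s t) (q h)"
      proof (cases "s < t")
        case True
        then have st: "t = s + h" "min s t = s" by (auto simp: h_def)
        have "T (min s t) (q h) = (T t x - T s x) /\<^sub>R h"
          unfolding st using s h by (simp add: q_def T_add T_scaleR T_diff)
        also have "\<dots> = (T s x - T t x) /\<^sub>R (s - t)"
        proof -
          have "inverse h = - inverse (s - t)"
            using True by (simp add: h_def flip: inverse_minus_eq)
          then show ?thesis by (simp add: scaleR_diff_right)
        qed
        finally show ?thesis by simp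
      next
        case False
        then have "s = t + h" "min s t = t" by (auto simp: h_def)
        then show ?thesis using t h by (simp add: q_def T_add T_scaleR T_diff)
      qed
      have mm: "min s t \<ge> 0" using s t by simp
      have "(T s x - T t x) /\<^sub>R (s - t) - (- T t (A x))
          = T (min s t) (q h + A x) - (T (min s t) (A x) - T t (A x))"
        unfolding eq T_plus[OF mm] by simp
      also have "norm \<dots> \<le> norm (T (min s t) (q h + A x)) + norm (T (min s t) (A x) - T t (A x))"
        by (rule norm_triangle_ineq4)
      also have "norm (T (min s t) (q h + A x)) \<le> M * norm (q h + A x)"
        using M(2) mm by auto
      finally show ?thesis by (simp add: h_def)
    qed
    then show "eventually (\<lambda>s. norm ((T s x - T t x) /\<^sub>R (s - t) - (- T t (A x)))
        \<le> M * norm (q \<bar>s - t\<bar> + A x) + norm (T (min s t) (A x) - T t (A x))) (at t)"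
      using t by (auto simp: eventually_at dist_real_def intro!: exI[of _ t])
  qed
  then have "((\<lambda>s. (T s x - T t x) /\<^sub>R (s - t)) \<longlongrightarrow> - T t (A x)) (at t)"
    by (rule LIM_zero_cancel)
  then show ?thesis by (simp add: has_vector_derivative_iff_quotient)
qed

lemma A_linear:
  shows D_zero: "0 \<in> D" and A_zero: "A 0 = 0"
    and D_add: "x \<in> D \<Longrightarrow> y \<in> D \<Longrightarrow> x + y \<in> D"
    and A_add: "x \<in> D \<Longrightarrow> y \<in> D \<Longrightarrow> A (x + y) = A x + A y"
    and D_scaleC: "x \<in> D \<Longrightarrow> c *\<^sub>C x \<in> D"
    and A_scaleC: "x \<in> D \<Longrightarrow> A (c *\<^sub>C x) = c *\<^sub>C A x"
proof -
  have ev: "eventually (\<lambda>h. h > (0::real)) (at_right 0)" by (rule eventually_at_right_less)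
  have "((\<lambda>t. (T t 0 - 0) /\<^sub>R t) \<longlongrightarrow> 0) (at_right 0)"
    by (rule tendsto_eventually, use ev in eventually_elim) (simp add: T_0)
  from D_I[OF this] A_eqI[OF this] show "0 \<in> D" "A 0 = 0" by auto
  {
    assume xy: "x \<in> D" "y \<in> D"
    have "((\<lambda>t. (T t x - x) /\<^sub>R t + (T t y - y) /\<^sub>R t) \<longlongrightarrow> - A x + - A y) (at_right 0)"
      by (intro tendsto_add D_tendsto xy)
    moreover have "eventually (\<lambda>t. (T t x - x) /\<^sub>R t + (T t y - y) /\<^sub>R t
        = (T t (x + y) - (x + y)) /\<^sub>R t) (at_right 0)"
      using ev by eventually_elim (simp add: T_plus algebra_simps)
    ultimately have "((\<lambda>t. (T t (x + y) - (x + y)) /\<^sub>R t) \<longlongrightarrow> - A x + - A y) (at_right 0)"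
      by (rule Lim_transform_eventually)
    from D_I[OF this] A_eqI[OF this] show "x + y \<in> D" "A (x + y) = A x + A y" by auto
  }
  {
    assume x: "x \<in> D"
    have "((\<lambda>t. c *\<^sub>C ((T t x - x) /\<^sub>R t)) \<longlongrightarrow> c *\<^sub>C (- A x)) (at_right 0)"
      by (rule bounded_linear.tendsto[OF bounded_linear_scaleC D_tendsto[OF x]])
    moreover have "eventually (\<lambda>t. c *\<^sub>C ((T t x - x) /\<^sub>R t)
        = (T t (c *\<^sub>C x) - c *\<^sub>C x) /\<^sub>R t) (at_right 0)"
      using ev by eventually_elim (simp add: T_scaleC scaleC_scaleR_right scaleC_diff_right)
    ultimately have "((\<lambda>t. (T t (c *\<^sub>C x) - c *\<^sub>C x) /\<^sub>R t) \<longlongrightarrow> c *\<^sub>C (- A x)) (at_right 0)"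
      by (rule Lim_transform_eventually)
    from D_I[OF this] A_eqI[OF this] show "c *\<^sub>C x \<in> D" "A (c *\<^sub>C x) = c *\<^sub>C A x"
      by (auto simp: scaleC_minus_right)
  }
qed

lemma D_scaleR: "x \<in> D \<Longrightarrow> r *\<^sub>R x \<in> D" and A_scaleR: "x \<in> D \<Longrightarrow> A (r *\<^sub>R x) = r *\<^sub>R A x"
  using D_scaleC[of x "of_real r"] A_scaleC[of x "of_real r"] by (auto simp: scaleC_of_real)

lemma D_minus: "x \<in> D \<Longrightarrow> - x \<in> D" and A_minus: "x \<in> D \<Longrightarrow> A (- x) = - A x"
  using D_scaleR[of x "-1"] A_scaleR[of x "-1"] by auto

lemma D_diff: "x \<in> D \<Longrightarrow> y \<in> D \<Longrightarrow> x - y \<in> D"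
  and A_diff: "x \<in> D \<Longrightarrow> y \<in> D \<Longrightarrow> A (x - y) = A x - A y"
  using D_add[of x "- y"] A_add[of x "- y"] D_minus[of y] A_minus[of y] by auto

lemma D_sum: "(\<And>i. i \<in> I \<Longrightarrow> f i \<in> D) \<Longrightarrow> (\<Sum>i\<in>I. f i) \<in> D"
  by (induction I rule: infinite_finite_induct) (auto simp: D_zero D_add)

lemma A_sum: "(\<And>i. i \<in> I \<Longrightarrow> f i \<in> D) \<Longrightarrow> A (\<Sum>i\<in>I. f i) = (\<Sum>i\<in>I. A (f i))"
  by (induction I rule: infinite_finite_induct) (auto simp: A_zero A_add D_sum)

text \<open>The means of an orbit over short time intervals lie in the domain and approximate its
  initial value.\<close>

lemma D_dense: "closure D = UNIV"
proof -
  have "x \<in> closure D" for x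
  proof -
    define F where "F = (\<lambda>u. integral {0..u} (\<lambda>s. T s x))"
    have cont: "continuous_on {a..b} (\<lambda>s. T s x)" if "a \<ge> 0" for a b
      by (rule continuous_on_subset[OF T_continuous]) (use that in auto)
    have int: "(\<lambda>s. T s x) integrable_on {a..b}" if "a \<ge> 0" for a b
      by (rule integrable_continuous_interval[OF cont[OF that]])
    have deriv: "((\<lambda>r. (F (h + r) - F h) /\<^sub>R r) \<longlongrightarrow> T h x) (at_right 0)" if h: "h \<ge> 0" for h
    proof -
      have "(F has_vector_derivative T h x) (at h within {0..h+1})"
        unfolding F_def by (rule integral_has_vector_derivative[OF cont]) (use h in auto)
      then have "(F has_vector_derivative T h x) (at h within {h..h+1})"
        by (rule has_vector_derivative_within_subset) (use h in auto)
      moreover have "at h within {h..h+1} = at_right h"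
        by (rule at_within_Icc_at_right) simp
      ultimately have "((\<lambda>s. (F s - F h) /\<^sub>R (s - h)) \<longlongrightarrow> T h x) (at_right h)"
        by (simp add: has_vector_derivative_iff_quotient)
      then show ?thesis
        by (subst (asm) filterlim_at_right_to_0) (simp add: add.commute)
    qed
    have F0: "F 0 = 0" by (simp add: F_def)
    have inD: "F h \<in> D" if h: "h > 0" for h
    proof (rule D_I)
      have "((\<lambda>r. (F (h + r) - F h) /\<^sub>R r - (F (0 + r) - F 0) /\<^sub>R r) \<longlongrightarrow> T h x - T 0 x) (at_right 0)"
        by (intro tendsto_diff deriv) (use h in auto)
      moreover have "eventually (\<lambda>r. (F (h + r) - F h) /\<^sub>R r - (F (0 + r) - F 0) /\<^sub>R r
          = (T r (F h) - F h) /\<^sub>R r) (at_right 0)"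
        using eventually_at_right_less[of 0]
      proof eventually_elim
        case (elim r)
        have "T r (F h) = integral {0..h} (T r \<circ> (\<lambda>s. T s x))"
          unfolding F_def using elim int by (intro integral_linear[symmetric] T_bounded_linear) auto
        also have "\<dots> = integral {0..h} (\<lambda>s. T (s + r) x)"
          using elim h by (intro integral_cong) (simp add: T_add add.commute[of _ r])
        also have "\<dots> = integral {r..h + r} (\<lambda>s. T s x)"
        proof (rule integral_unique)
          have "((\<lambda>s. T s x) has_integral integral {r..h + r} (\<lambda>s. T s x)) {0 + r..h + r}"
            using int[of r "h + r"] elim by (simp add: has_integral_integral)
          then show "((\<lambda>s. T (s + r) x) has_integral integral {r..h + r} (\<lambda>s. T s x)) {0..h}"
            by (subst (asm) has_integral_shift_Icc_real[symmetric]) (simp add: o_def add.commute)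
        qed
        also have "\<dots> = F (h + r) - F r"
          using Henstock_Kurzweil_Integration.integral_combine[where f = "\<lambda>s. T s x" and a = 0 and c = r and b = "h + r"] elim h int
          by (simp add: F_def algebra_simps)
        finally have TF: "T r (F h) = F (h + r) - F r" .
        show ?case unfolding TF by (simp add: F0 algebra_simps)
      qed
      ultimately show "((\<lambda>r. (T r (F h) - F h) /\<^sub>R r) \<longlongrightarrow> T h x - T 0 x) (at_right 0)"
        by (rule Lim_transform_eventually)
    qed
    have "((\<lambda>r. (F (0 + r) - F 0) /\<^sub>R r) \<longlongrightarrow> T 0 x) (at_right 0)" by (rule deriv) simp
    then have lim: "((\<lambda>r. F r /\<^sub>R r) \<longlongrightarrow> x) (at_right 0)" by (simp add: F0)
    show "x \<in> closure D"
    proof (rule Lim_in_closed_set[OF closed_closure _ _ lim])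
      show "eventually (\<lambda>r. F r /\<^sub>R r \<in> closure D) (at_right 0)"
        using eventually_at_right_less[of 0]
        by eventually_elim (meson D_scaleR closure_subset inD subsetD)
    qed simp
  qed
  then show ?thesis by auto
qed

end

text \<open>A number \<open>w > 0\<close> for which \<open>A + w\<close> is boundedly invertible; the inverse is \<open>S\<close>, and
  \<open>V\<close> is the Cayley transform.\<close>

locale cayley_setting = semigroup_generator +
  fixes w :: real
  assumes w_pos: "w > 0" and w_resolvent: "complex_of_real w \<in> resolvent_set D (\<lambda>x. - A x)"
begin

abbreviation "S \<equiv> shift_inverse D A w"
abbreviation "V \<equiv> cayley D A w"

lemma S_bounded_linear: "bounded_linear S" and S_scaleC: "S (c *\<^sub>C x) = c *\<^sub>C S x"
  using w_resolvent by (auto simp: resolvent_set_def shift_inverse_def bounded_clinear_def)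

lemma shift_bij: "bij_betw (\<lambda>x. w *\<^sub>R x + A x) D UNIV"
  using w_resolvent by (simp add: resolvent_set_def scaleC_of_real)

lemma S_D: "S x \<in> D" and S_right: "w *\<^sub>R S x + A (S x) = x"
proof -
  have S: "S = inv_into D (\<lambda>x. w *\<^sub>R x + A x)"
    by (simp add: shift_inverse_def resolvent_def scaleC_of_real)
  show "S x \<in> D" unfolding S
    by (rule inv_into_into) (metis UNIV_I bij_betw_imp_surj_on shift_bij)
  show "w *\<^sub>R S x + A (S x) = x" unfolding S
    using bij_betw_inv_into_right[OF shift_bij, of x] by simp
qed

lemma A_S: "A (S x) = x - w *\<^sub>R S x"
  using S_right[of x] by (simp add: algebra_simps)

lemma S_left: "x \<in> D \<Longrightarrow> S (w *\<^sub>R x + A x) = x"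
  by (rule inj_onD[OF bij_betw_imp_inj_on[OF shift_bij]]) (simp_all add: S_right S_D)

lemma A_closed:
  assumes x: "\<And>n. x n \<in> D" and lim: "x \<longlonglongrightarrow> y" and Alim: "(\<lambda>n. A (x n)) \<longlonglongrightarrow> z"
  shows "y \<in> D" and "A y = z"
proof -
  have "(\<lambda>n. S (w *\<^sub>R x n + A (x n))) \<longlonglongrightarrow> S (w *\<^sub>R y + z)"
    by (intro bounded_linear.tendsto[OF S_bounded_linear] tendsto_intros lim Alim)
  then have "x \<longlonglongrightarrow> S (w *\<^sub>R y + z)" by (simp add: S_left[OF x])
  with lim have y: "y = S (w *\<^sub>R y + z)" using LIMSEQ_unique by blast
  show "y \<in> D" by (subst y) (rule S_D)
  have "w *\<^sub>R y + A y = w *\<^sub>R y + z" using S_right[of "w *\<^sub>R y + z"] by (simp flip: y)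
  then show "A y = z" by simp
qed

lemma D2_dense: "closure {x \<in> D. A x \<in> D} = UNIV"
proof -
  have SD: "S ` D \<subseteq> {x \<in> D. A x \<in> D}"
    by (auto simp: S_D A_S intro!: D_diff D_scaleR)
  have "range S = S ` closure D" by (simp add: D_dense)
  also have "\<dots> \<subseteq> closure (S ` D)"
    by (rule image_closure_subset[OF _ closed_closure closure_subset])
      (intro linear_continuous_on S_bounded_linear)
  also have "\<dots> \<subseteq> closure {x \<in> D. A x \<in> D}" by (rule closure_mono[OF SD])
  finally have "range S \<subseteq> closure {x \<in> D. A x \<in> D}" .
  moreover have "D \<subseteq> range S" using S_left by (metis rangeI subsetI)
  ultimately have "closure D \<subseteq> closure {x \<in> D. A x \<in> D}"
    by (meson closed_closure closure_minimal subset_trans)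
  then show ?thesis unfolding D_dense by blast
qed

lemma V_eq: "V x = x - (2 * w) *\<^sub>R S x"
  by (simp add: cayley_def A_S algebra_simps flip: scaleR_add_left)

lemma V_bounded_linear: "bounded_linear V"
  unfolding V_eq by (intro bounded_linear_sub bounded_linear_ident
    bounded_linear_compose[OF bounded_linear_scaleR_right S_bounded_linear])

lemma V_scaleC: "V (c *\<^sub>C x) = c *\<^sub>C V x"
  by (simp add: V_eq S_scaleC scaleC_diff_right scaleC_scaleR_right)

end

section \<open>Power bounded operators\<close>

text \<open>A bounded complex-linear operator whose powers have norm at most \<open>M\<close>.\<close>

locale power_bounded =
  fixes V :: "'a::complex_hilbert \<Rightarrow> 'a" and M :: real
  assumes V_bl: "bounded_linear V" and V_cl: "V (c *\<^sub>C x) = c *\<^sub>C V x"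
    and M_ge_1: "M \<ge> 1" and V_power_le: "norm ((V ^^ n) x) \<le> M * norm x"
begin

lemmas V_power_bl = bounded_linear_funpow[OF V_bl]
lemmas V_scaleR = linear_scale[OF bounded_linear.linear[OF V_bl]]
lemmas V_sum = linear_sum[OF bounded_linear.linear[OF V_bl]]
lemmas V_power_diff = linear_diff[OF bounded_linear.linear[OF V_power_bl]]

lemma V_power_cl: "(V ^^ n) (c *\<^sub>C x) = c *\<^sub>C (V ^^ n) x"
  by (induction n) (auto simp: V_cl)

lemma V_power_mono: "m \<le> n \<Longrightarrow> norm ((V ^^ n) x) \<le> M * norm ((V ^^ m) x)"
  using V_power_le[of "n - m" "(V ^^ m) x"] by (metis comp_apply funpow_add le_add_diff_inverse2)

lemma dft_V: "dft N (\<lambda>k. V (g k)) z = V (dft N g z)"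
  by (simp add: dft_def V_sum V_cl)

text \<open>The orbit of \<open>x\<close> is cut off by a triangular weight of height \<open>1\<close> and slope \<open>1 / n\<close>. The Fourier
  transform turns the difference equation \<open>u (k + 1) - V (u k) = f k\<close> of the weighted orbit \<open>u\<close> into
  \<open>(z - V) (dft N u z) = dft N f z\<close>, so that \<open>(1 - V) (dft N u z) = (1 - z) (dft N u z) + dft N f z\<close>.
  Where \<open>cmod (1 - z)\<close> is at most \<open>B = n powr (- 1 / \<alpha>)\<close> this is small trivially; elsewhere the
  resolvent bound estimates the first term on the right by a multiple of \<open>B * n\<close> times
  \<open>dft N f z\<close>. Parseval's identity returns to the orbit, and power boundedness transfers the mean
  value over \<open>k \<le> n\<close> to \<open>k = n\<close>.\<close>

lemma decay_of_resolvent_bound: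
  assumes \<alpha>: "\<alpha> \<ge> 1" and C: "C \<ge> 0"
    and bound: "\<And>z x. cmod z = 1 \<Longrightarrow> z \<noteq> 1 \<Longrightarrow>
      norm x \<le> C * cmod (1 - z) powr (- \<alpha>) * norm (z *\<^sub>C x - V x)"
    and n: "n > 0"
  shows "norm ((V ^^ n) (x - V x)) \<le> 4 * M\<^sup>2 * (C + 2) * real n powr (- 1 / \<alpha>) * norm x"
proof -
  define B where "B = real n powr (- 1 / \<alpha>)"
  define N where "N = 2 * n"
  define \<psi> where "\<psi> = (\<lambda>k. real (min k (N - k)) / real n)"
  define u where "u = (\<lambda>k. \<psi> k *\<^sub>R (V ^^ k) x)"
  define f where "f = (\<lambda>k. u (Suc k) - V (u k))"
  define a where "a = (\<lambda>k. u k - V (u k))"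
  have N: "N > 0" using n by (simp add: N_def)
  have B: "B > 0" "B \<le> 1"
    using n \<alpha> powr_mono[of "- 1 / \<alpha>" 0 "real n"] by (auto simp: B_def)
  have B\<alpha>: "B powr (1 - \<alpha>) = B * real n"
  proof -
    have "B powr (1 - \<alpha>) = B * B powr (- \<alpha>)"
      using B by (simp add: powr_add[symmetric] powr_mult_base)
    also have "B powr (- \<alpha>) = real n"
      using n \<alpha> by (simp add: B_def powr_powr)
    finally show ?thesis .
  qed
  have B1: "B * real n \<ge> 1"
    using B \<alpha> powr_mono2'[of "1 - \<alpha>" B 1] by (simp add: B\<alpha>[symmetric])
  have \<psi>01: "0 \<le> \<psi> k" "\<psi> k \<le> 1" for k
    using n by (auto simp: \<psi>_def N_def min_def)
  have un: "norm (u k) \<le> M * norm x" for k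
  proof -
    have "norm (u k) \<le> \<psi> k * (M * norm x)"
      unfolding u_def using V_power_le[of k x] \<psi>01 by (simp add: mult_left_mono)
    also have "\<dots> \<le> 1 * (M * norm x)"
      using \<psi>01 M_ge_1 by (intro mult_right_mono) auto
    finally show ?thesis by simp
  qed
  have fn: "norm (f k) \<le> M * norm x / real n" if "k < N" for k
  proof -
    have "f k = (\<psi> (Suc k) - \<psi> k) *\<^sub>R (V ^^ Suc k) x"
      by (simp add: f_def u_def V_scaleR scaleR_diff_left)
    moreover have "\<bar>\<psi> (Suc k) - \<psi> k\<bar> = 1 / real n"
    proof -
      have "\<bar>real (min (Suc k) (N - Suc k)) - real (min k (N - k))\<bar> = 1"
        using that by (auto simp: N_def min_def of_nat_diff)
      then show ?thesis using n by (simp add: \<psi>_def flip: diff_divide_distrib)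
    qed
    ultimately have "norm (f k) = 1 / real n * norm ((V ^^ Suc k) x)" by simp
    also have "\<dots> \<le> 1 / real n * (M * norm x)"
      using V_power_le[of "Suc k" x] by (intro mult_left_mono) auto
    finally show ?thesis by simp
  qed
  have key: "norm (dft N a z) \<le> B * norm (dft N u z) + (C + 1) * (B * real n) * norm (dft N f z)"
    if z: "cmod z = 1" "z \<noteq> 1" for z
  proof -
    define d where "d = cmod (1 - z)"
    have d: "d > 0" using z by (simp add: d_def)
    have feq: "dft N f z = z *\<^sub>C dft N u z - V (dft N u z)"
      unfolding f_def dft_diff dft_V using dft_shift[of z u N] z
      by (simp add: u_def \<psi>_def)
    have "dft N a z = (1 - z) *\<^sub>C dft N u z + dft N f z"
      unfolding a_def dft_diff dft_V feq by (simp add: scaleC_diff_left)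
    then have 1: "norm (dft N a z) \<le> d * norm (dft N u z) + norm (dft N f z)"
      using norm_triangle_ineq[of "(1 - z) *\<^sub>C dft N u z" "dft N f z"] by (simp add: norm_scaleC d_def)
    have f1: "norm (dft N f z) \<le> (B * real n) * norm (dft N f z)"
      using B1 mult_right_mono[of 1 "B * real n" "norm (dft N f z)"] by simp
    show ?thesis
    proof (cases "d \<le> B")
      case True
      then have "d * norm (dft N u z) \<le> B * norm (dft N u z)" by (intro mult_right_mono) auto
      moreover have "0 \<le> C * (B * real n * norm (dft N f z))" using C B by simp
      ultimately show ?thesis using 1 f1 by (simp add: algebra_simps)
    next
      case False
      have "d * norm (dft N u z) \<le> d * (C * d powr (- \<alpha>) * norm (dft N f z))"
        using bound[OF z, of "dft N u z"] d unfolding feq d_def by (intro mult_left_mono) auto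
      also have "\<dots> = C * (d powr (1 - \<alpha>) * norm (dft N f z))"
        using d by (simp add: powr_add[symmetric] powr_mult_base mult_ac)
      also have "\<dots> \<le> C * (B powr (1 - \<alpha>) * norm (dft N f z))"
        using False B \<alpha> C powr_mono2'[of "1 - \<alpha>" B d] by (intro mult_left_mono mult_right_mono) auto
      finally have "d * norm (dft N u z) \<le> C * (B * real n * norm (dft N f z))"
        by (simp add: B\<alpha>)
      moreover have "0 \<le> B * norm (dft N u z)" using B by simp
      ultimately show ?thesis using 1 f1 by (simp add: algebra_simps)
    qed
  qed
  have "(\<Sum>k<N. (norm (a k))\<^sup>2) \<le> real (card {0::nat, 1}) * (\<Sum>i\<in>{0::nat, 1}.
      (if i = 0 then B else (C + 1) * (B * real n))\<^sup>2 * (\<Sum>k<N. (norm ((if i = 0 then u else f) k))\<^sup>2))"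
  proof (rule dft_comparison)
    fix j
    show "norm (dft N a (node N j)) \<le> (\<Sum>i\<in>{0::nat, 1}. (if i = 0 then B else (C + 1) * (B * real n))
        * norm (dft N (if i = 0 then u else f) (node N j)))"
      using key[of "node N j"] node_neq_1[OF N] by simp
  qed simp
  also have "\<dots> = 2 * (B\<^sup>2 * (\<Sum>k<N. (norm (u k))\<^sup>2)
      + ((C + 1) * (B * real n))\<^sup>2 * (\<Sum>k<N. (norm (f k))\<^sup>2))"
    by simp
  also have "\<dots> \<le> 2 * (B\<^sup>2 * (\<Sum>k<N. (M * norm x)\<^sup>2)
      + ((C + 1) * (B * real n))\<^sup>2 * (\<Sum>k<N. (M * norm x / real n)\<^sup>2))"
    by (intro mult_left_mono add_mono sum_mono power_mono un fn) auto
  also have "\<dots> = 4 * real n * (B * M * norm x)\<^sup>2 * (1 + (C + 1)\<^sup>2)"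
  proof -
    have "((C + 1) * (B * real n))\<^sup>2 * (M * norm x / real n)\<^sup>2 = (C + 1)\<^sup>2 * (B * M * norm x)\<^sup>2"
      using n by (simp add: power_mult_distrib power_divide)
    then have "((C + 1) * (B * real n))\<^sup>2 * (\<Sum>k<N. (M * norm x / real n)\<^sup>2)
        = 2 * real n * ((C + 1)\<^sup>2 * (B * M * norm x)\<^sup>2)"
      by (simp add: N_def)
    then show ?thesis by (simp add: N_def power_mult_distrib distrib_left)
  qed
  finally have upper: "(\<Sum>k<N. (norm (a k))\<^sup>2) \<le> 4 * real n * (B * M * norm x)\<^sup>2 * (1 + (C + 1)\<^sup>2)" .
  define y where "y = norm ((V ^^ n) (x - V x))"
  have ak: "(real k / real n * (y / M))\<^sup>2 \<le> (norm (a k))\<^sup>2" if "k \<le> n" for k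
  proof (rule power_mono)
    have "a k = \<psi> k *\<^sub>R (V ^^ k) (x - V x)"
      by (simp add: a_def u_def V_scaleR V_power_diff scaleR_diff_right flip: funpow_swap1)
    moreover have "\<psi> k = real k / real n" using that by (simp add: \<psi>_def N_def)
    ultimately have na: "norm (a k) = real k / real n * norm ((V ^^ k) (x - V x))" by simp
    have "y / M \<le> norm ((V ^^ k) (x - V x))"
      using V_power_mono[OF that, of "x - V x"] M_ge_1 by (simp add: y_def field_simps)
    then show "real k / real n * (y / M) \<le> norm (a k)"
      unfolding na by (intro mult_left_mono) auto
    show "0 \<le> real k / real n * (y / M)" using M_ge_1 by (simp add: y_def)
  qed
  have cancel: "p \<le> 12 * q * r" if "real n / 3 * p \<le> 4 * real n * q * r" for p q r
    by (rule mult_left_le_imp_le[of "real n"]) (use n that in \<open>simp_all add: algebra_simps\<close>)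
  have cubes: "real m ^ 3 \<le> 3 * (\<Sum>k\<le>m. (real k)\<^sup>2)" for m
    by (induction m) (auto simp: power2_eq_square power3_eq_cube algebra_simps)
  have "real n / 3 * (y / M)\<^sup>2 = (real n ^ 3 / 3) * ((y / M)\<^sup>2 / (real n)\<^sup>2)"
    using n by (simp add: power3_eq_cube power2_eq_square)
  also have "\<dots> \<le> (\<Sum>k\<le>n. (real k)\<^sup>2) * ((y / M)\<^sup>2 / (real n)\<^sup>2)"
    using cubes[of n] by (intro mult_right_mono) auto
  also have "\<dots> = (\<Sum>k\<le>n. (real k / real n * (y / M))\<^sup>2)"
    by (simp add: sum_distrib_left sum_divide_distrib power_mult_distrib power_divide mult_ac)
  also have "\<dots> \<le> (\<Sum>k\<le>n. (norm (a k))\<^sup>2)" by (intro sum_mono ak) auto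
  also have "\<dots> \<le> (\<Sum>k<N. (norm (a k))\<^sup>2) + (norm (a N))\<^sup>2"
  proof -
    have "(\<Sum>k\<le>n. (norm (a k))\<^sup>2) \<le> (\<Sum>k<Suc N. (norm (a k))\<^sup>2)"
      by (rule sum_mono2) (auto simp: N_def)
    then show ?thesis by simp
  qed
  also have "a N = 0" by (simp add: a_def u_def \<psi>_def V_scaleR)
  finally have "real n / 3 * (y / M)\<^sup>2 \<le> 4 * real n * (B * M * norm x)\<^sup>2 * (1 + (C + 1)\<^sup>2)"
    using upper by simp
  then have "(y / M)\<^sup>2 \<le> 12 * (B * M * norm x)\<^sup>2 * (1 + (C + 1)\<^sup>2)"
    by (rule cancel)
  also have "\<dots> \<le> 16 * (B * M * norm x)\<^sup>2 * (C + 2)\<^sup>2"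
  proof -
    have "12 * (1 + (C + 1)\<^sup>2) \<le> 16 * (C + 2)\<^sup>2"
      using C by (simp add: power2_eq_square algebra_simps)
    then have "(B * M * norm x)\<^sup>2 * (12 * (1 + (C + 1)\<^sup>2)) \<le> (B * M * norm x)\<^sup>2 * (16 * (C + 2)\<^sup>2)"
      by (rule mult_left_mono) simp
    then show ?thesis by (simp only: mult_ac)
  qed
  also have "\<dots> = (4 * (B * M * norm x) * (C + 2))\<^sup>2" by (simp add: power_mult_distrib)
  finally have "y / M \<le> 4 * (B * M * norm x) * (C + 2)"
    by (rule power2_le_imp_le) (use C B M_ge_1 in auto)
  then have "y \<le> 4 * (B * M * norm x) * (C + 2) * M" using M_ge_1 by (simp add: field_simps)
  then show ?thesis by (simp add: y_def B_def power2_eq_square algebra_simps)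
qed

text \<open>On an approximate eigenvector \<open>x\<close>, the operator \<open>V ^^ n\<close> acts like \<open>z ^ n\<close> up to an error of
  \<open>n * M\<close> times the defect \<open>z x - V x\<close>.\<close>

lemma V_power_approx:
  assumes "cmod z = 1"
  shows "norm ((V ^^ n) x) \<ge> norm x - real n * M * norm (z *\<^sub>C x - V x)"
proof -
  have "norm ((V ^^ n) x - z ^ n *\<^sub>C x) \<le> real n * M * norm (z *\<^sub>C x - V x)"
  proof (induction n)
    case (Suc n)
    have "(V ^^ Suc n) x - z ^ Suc n *\<^sub>C x
        = z *\<^sub>C ((V ^^ n) x - z ^ n *\<^sub>C x) - (V ^^ n) (z *\<^sub>C x - V x)"
      by (simp add: V_power_diff V_power_cl scaleC_diff_right scaleC_scaleC funpow_swap1)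
    also have "norm \<dots> \<le> norm ((V ^^ n) x - z ^ n *\<^sub>C x) + M * norm (z *\<^sub>C x - V x)"
      using assms norm_triangle_ineq4 V_power_le[of n "z *\<^sub>C x - V x"]
      by (smt (verit, best) mult_cancel_right1 norm_scaleC)
    finally show ?case using Suc by (simp add: algebra_simps)
  qed simp
  then show ?thesis
    using norm_triangle_ineq3[of "z ^ n *\<^sub>C x" "(V ^^ n) x"] assms
    by (simp add: norm_scaleC norm_power norm_minus_commute)
qed

text \<open>The converse, which needs no inner product. In \<open>(1 - z) V\<^sup>n x = V\<^sup>n (x - V x) - V\<^sup>n (z x - V x)\<close>
  the number \<open>n\<close> is so chosen, of order \<open>cmod (1 - z) powr (- \<alpha>)\<close>, that the first term on the right is
  at most a quarter of \<open>cmod (1 - z) * norm x\<close>.\<close>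

lemma resolvent_bound_of_decay:
  assumes \<alpha>: "\<alpha> \<ge> 1" and C: "C > 0" and n0: "n0 > 0"
    and decay: "\<And>n x. n \<ge> n0 \<Longrightarrow> norm ((V ^^ n) (x - V x)) \<le> C * real n powr (- 1 / \<alpha>) * norm x"
  shows "\<exists>K\<ge>0. \<exists>\<delta>>0. \<forall>z x. cmod z = 1 \<longrightarrow> z \<noteq> 1 \<longrightarrow> cmod (1 - z) \<le> \<delta> \<longrightarrow>
      norm x \<le> K * cmod (1 - z) powr (- \<alpha>) * norm (z *\<^sub>C x - V x)"
proof -
  define \<delta> where "\<delta> = min 1 (min (4 * C) (4 * C * real n0 powr (- 1 / \<alpha>)))"
  define K where "K = 4 / 3 * M * (1 + 2 * (4 * C) powr \<alpha>)"
  have \<delta>: "\<delta> > 0" using C n0 by (simp add: \<delta>_def)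
  have "norm x \<le> K * cmod (1 - z) powr (- \<alpha>) * norm (z *\<^sub>C x - V x)"
    if z: "cmod z = 1" "z \<noteq> 1" "cmod (1 - z) \<le> \<delta>" for z x
  proof -
    define d where "d = cmod (1 - z)"
    have d: "d > 0" "d \<le> 1" "d \<le> 4 * C" "d \<le> 4 * C * real n0 powr (- 1 / \<alpha>)"
      using z by (auto simp: d_def \<delta>_def)
    define r where "r = (4 * C / d) powr \<alpha>"
    define n where "n = nat \<lceil>r\<rceil>"
    have r1: "r \<ge> 1" unfolding r_def using d \<alpha> by (intro ge_one_powr_ge_zero) auto
    have n: "real n \<ge> r" "real n \<le> 2 * r" using r1 unfolding n_def by linarith+
    have "real n0 powr (1 / \<alpha>) \<le> 4 * C / d"
      using d n0 by (simp add: powr_minus field_simps)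
    then have "(real n0 powr (1 / \<alpha>)) powr \<alpha> \<le> r"
      unfolding r_def using \<alpha> by (intro powr_mono2) auto
    then have "real n0 \<le> r" using \<alpha> n0 by (simp add: powr_powr)
    then have nn0: "n \<ge> n0" using n by linarith
    have "C * real n powr (- 1 / \<alpha>) \<le> C * r powr (- 1 / \<alpha>)"
      using n r1 \<alpha> C by (intro mult_left_mono powr_mono2') auto
    also have "r powr (- 1 / \<alpha>) = d / (4 * C)"
      using \<alpha> d C by (simp add: r_def powr_powr powr_minus_divide)
    finally have Cn: "C * real n powr (- 1 / \<alpha>) \<le> d / 4" using C by simp
    define e where "e = norm (z *\<^sub>C x - V x)"
    have "(1 - z) *\<^sub>C (V ^^ n) x = (V ^^ n) (x - V x) - (V ^^ n) (z *\<^sub>C x - V x)"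
      by (simp add: V_power_diff V_power_cl scaleC_diff_left)
    then have "d * norm ((V ^^ n) x) \<le> norm ((V ^^ n) (x - V x)) + norm ((V ^^ n) (z *\<^sub>C x - V x))"
      by (metis d_def norm_scaleC norm_triangle_ineq4)
    also have "\<dots> \<le> d / 4 * norm x + M * e"
    proof (rule add_mono)
      have "norm ((V ^^ n) (x - V x)) \<le> C * real n powr (- 1 / \<alpha>) * norm x" by (rule decay[OF nn0])
      also have "\<dots> \<le> d / 4 * norm x" using Cn by (intro mult_right_mono) auto
      finally show "norm ((V ^^ n) (x - V x)) \<le> d / 4 * norm x" .
    qed (simp add: e_def V_power_le)
    finally have 1: "d * norm ((V ^^ n) x) \<le> d / 4 * norm x + M * e" .
    have "d * (norm x - real n * M * e) \<le> d * norm ((V ^^ n) x)"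
      using V_power_approx[OF z(1)] d by (intro mult_left_mono) (auto simp: e_def)
    with 1 have "3 / 4 * (d * norm x) \<le> M * e * (1 + d * real n)" by (simp add: algebra_simps)
    then have "norm x \<le> 4 / 3 * (M * e * (1 / d + real n))"
      using d by (simp add: field_simps)
    also have "\<dots> \<le> 4 / 3 * (M * e * ((1 + 2 * (4 * C) powr \<alpha>) * d powr (- \<alpha>)))"
    proof (intro mult_left_mono)
      have "1 / d \<le> d powr (- \<alpha>)"
        using d \<alpha> powr_mono'[of "- \<alpha>" "- 1" d] by (simp add: powr_minus_divide)
      moreover have "real n \<le> 2 * (4 * C) powr \<alpha> * d powr (- \<alpha>)"
        using n C d by (simp add: r_def powr_divide powr_minus_divide)
      ultimately show "1 / d + real n \<le> (1 + 2 * (4 * C) powr \<alpha>) * d powr (- \<alpha>)"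
        by (simp add: algebra_simps)
      show "0 \<le> M * e" using M_ge_1 by (simp add: e_def)
    qed simp
    finally show ?thesis by (simp add: K_def d_def e_def mult_ac)
  qed
  moreover have "K \<ge> 0" using M_ge_1 by (simp add: K_def)
  ultimately show ?thesis using \<delta> by blast
qed

end

section \<open>Resolvent bounds for the generator and for its Cayley transform\<close>

lemma bounded_bilinear_scaleC: "bounded_bilinear ((*\<^sub>C) :: complex \<Rightarrow> 'a::complex_hilbert \<Rightarrow> 'a)"
proof
  fix r c and x :: 'a
  show "(r *\<^sub>R c) *\<^sub>C x = r *\<^sub>R (c *\<^sub>C x)"
    by (simp add: scaleR_conv_of_real scaleC_scaleC[symmetric] scaleC_of_real)
  show "c *\<^sub>C (r *\<^sub>R x) = r *\<^sub>R (c *\<^sub>C x)" by (rule scaleC_scaleR_right)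
next
  show "\<exists>K. \<forall>c (x::'a). norm (c *\<^sub>C x) \<le> norm c * norm x * K"
    by (intro exI[of _ 1]) (simp add: norm_scaleC)
qed (simp_all add: scaleC_add_left scaleC_add_right)

lemma mean_value_inequality:
  fixes f :: "real \<Rightarrow> 'a::real_normed_vector"
  assumes ab: "a \<le> b" and cont: "continuous_on {a..b} f"
    and deriv: "\<And>s. a < s \<Longrightarrow> s < b \<Longrightarrow> (f has_vector_derivative f' s) (at s)"
    and le: "\<And>s. a < s \<Longrightarrow> s < b \<Longrightarrow> norm (f' s) \<le> B"
  shows "norm (f b - f a) \<le> B * (b - a)"
proof (cases "a = b")
  case False
  have "norm (f b - f a) \<le> B * b - B * a"
  proof (rule differentiable_bound_general[OF _ cont _ deriv])
    show "((\<lambda>s. B * s) has_vector_derivative B) (at s)" for s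
      by (auto intro!: derivative_eq_intros simp flip: has_real_derivative_iff_has_vector_derivative)
  qed (use ab False le in \<open>auto intro!: continuous_intros\<close>)
  then show ?thesis by (simp add: algebra_simps)
qed simp

context semigroup_generator
begin

text \<open>The decay of the norm of \<open>(A + \<i>\<eta>)\<^sup>-\<^sup>1\<close> like \<open>\<bar>\<eta>\<bar> powr (- \<beta>)\<close> as \<open>\<bar>\<eta>\<bar>\<close> tends to infinity. It is
  stated as a lower bound for \<open>A + \<i>\<eta>\<close>, which is all that is used and makes sense whether or not
  \<open>A + \<i>\<eta>\<close> is surjective.\<close>

definition resolvent_decay :: "real \<Rightarrow> bool" where
  "resolvent_decay \<beta> \<longleftrightarrow> (\<exists>C>0. \<exists>r\<ge>1. \<forall>\<eta> u. u \<in> D \<longrightarrow> \<bar>\<eta>\<bar> \<ge> r \<longrightarrow>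
     norm u \<le> C * \<bar>\<eta>\<bar> powr (- \<beta>) * norm (A u + (\<i> * of_real \<eta>) *\<^sub>C u))"

lemma D_of_differentiable:
  assumes "(\<lambda>s. T s x) differentiable (at t)" "t > 0"
  shows "T t x \<in> D"
proof -
  obtain y where "((\<lambda>s. T s x) has_vector_derivative y) (at t)"
    using assms(1) vector_derivative_works by blast
  then have "((\<lambda>s. T s x) has_vector_derivative y) (at_right t)"
    by (rule has_vector_derivative_at_within)
  then have "((\<lambda>h. (T (h + t) x - T t x) /\<^sub>R h) \<longlongrightarrow> y) (at_right 0)"
    unfolding has_vector_derivative_iff_quotient by (subst (asm) filterlim_at_right_to_0) simp
  moreover have "eventually (\<lambda>h. (T (h + t) x - T t x) /\<^sub>R h = (T h (T t x) - T t x) /\<^sub>R h) (at_right 0)"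
    using eventually_at_right_less[of 0] by eventually_elim (use assms(2) in \<open>simp add: T_add\<close>)
  ultimately have "((\<lambda>h. (T h (T t x) - T t x) /\<^sub>R h) \<longlongrightarrow> y) (at_right 0)"
    by (rule Lim_transform_eventually)
  then show ?thesis by (rule D_I)
qed

text \<open>Pointwise, \<open>A \<circ> T t\<close> is a limit of bounded operators, so that the uniform boundedness principle
  applies.\<close>

lemma A_T_bounded_linear:
  assumes inD: "\<And>x. T t x \<in> D" and t: "t \<ge> 0"
  shows "bounded_linear (\<lambda>x. A (T t x))"
proof -
  define h where "h = (\<lambda>n::nat. 1 / (real n + 1))"
  have h0: "h n > 0" for n by (simp add: h_def)
  have "h \<longlonglongrightarrow> 0"
    using LIMSEQ_inverse_real_of_nat by (simp add: h_def[abs_def] inverse_eq_divide add.commute)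
  then have "filterlim h (at_right 0) sequentially"
    using h0 less_imp_neq[OF h0] by (auto simp: filterlim_at intro!: always_eventually)
  from filterlim_compose[OF D_tendsto[OF inD] this]
  have lim: "(\<lambda>n. (T (h n) (T t x) - T t x) /\<^sub>R h n) \<longlonglongrightarrow> - A (T t x)" for x .
  have "\<exists>B>0. \<forall>n\<in>UNIV. \<forall>x. norm ((T (h n) (T t x) - T t x) /\<^sub>R h n) \<le> B * norm x"
  proof (rule uniform_boundedness)
    fix n
    show "bounded_linear (\<lambda>x. (T (h n) (T t x) - T t x) /\<^sub>R h n)"
      using h0[of n] t by (intro bounded_linear_intros bounded_linear_compose[OF bounded_linear_scaleR_right]
        bounded_linear_sub bounded_linear_compose[OF T_bounded_linear] T_bounded_linear) auto
  next
    fix x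
    have "Bseq (\<lambda>n. (T (h n) (T t x) - T t x) /\<^sub>R h n)"
      using lim by (intro convergent_imp_Bseq convergentI)
    then show "\<exists>B. \<forall>n\<in>UNIV. norm ((T (h n) (T t x) - T t x) /\<^sub>R h n) \<le> B"
      by (auto simp: Bseq_def)
  qed
  then obtain B where B: "\<And>n x. norm ((T (h n) (T t x) - T t x) /\<^sub>R h n) \<le> B * norm x" by blast
  have "norm (A (T t x)) \<le> norm x * B" for x
  proof -
    have "norm (- A (T t x)) \<le> B * norm x"
      by (rule LIMSEQ_le_const2[OF tendsto_norm[OF lim]]) (use B in blast)
    then show ?thesis by (simp add: mult.commute)
  qed
  then show ?thesis
    using t by (intro bounded_linear_intro[where K=B]) (auto simp: T_plus T_scaleR A_add A_scaleR inD)
qed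

text \<open>The analogue of \<open>V_power_approx\<close> for orbits: the derivative of \<open>exp (- \<i>\<eta>s) T s u\<close> is
  \<open>- exp (- \<i>\<eta>s) T s (A u + \<i>\<eta>u)\<close>.\<close>

lemma orbit_approx:
  assumes u: "u \<in> D" and t: "t \<ge> 0" and M: "\<And>s x. 0 \<le> s \<Longrightarrow> s \<le> t \<Longrightarrow> norm (T s x) \<le> M * norm x"
  shows "norm (T t u) \<ge> norm u - t * M * norm (A u + (\<i> * of_real \<eta>) *\<^sub>C u)"
proof -
  define g where "g = A u + (\<i> * of_real \<eta>) *\<^sub>C u"
  define e where "e = (\<lambda>s::real. exp (- \<i> * of_real \<eta> * of_real s))"
  define f where "f = (\<lambda>s. e s *\<^sub>C T s u)"
  have ce: "cmod (e s) = 1" for s by (simp add: e_def norm_exp_eq_Re)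
  have de: "(e has_vector_derivative - \<i> * of_real \<eta> * e s) (at s)" for s
    unfolding e_def
    by (rule has_vector_derivative_real_field) (auto intro!: derivative_eq_intros)
  have df: "(f has_vector_derivative - (e s *\<^sub>C T s g)) (at s)" if s: "0 < s" for s
  proof -
    have "(f has_vector_derivative e s *\<^sub>C (- T s (A u)) + (- \<i> * of_real \<eta> * e s) *\<^sub>C T s u) (at s)"
      unfolding f_def
      by (rule bounded_bilinear.has_vector_derivative[OF bounded_bilinear_scaleC de T_has_derivative[OF u s]])
    moreover have "e s *\<^sub>C (- T s (A u)) + (- \<i> * of_real \<eta> * e s) *\<^sub>C T s u = - (e s *\<^sub>C T s g)"
      using s by (simp add: g_def T_plus T_scaleC scaleC_add_right scaleC_scaleC scaleC_minus_right
        scaleC_minus_left mult_ac)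
    ultimately show ?thesis by simp
  qed
  have "norm (f t - f 0) \<le> (M * norm g) * (t - 0)"
  proof (rule mean_value_inequality[OF t])
    have "continuous_on {0..t} e"
      using de by (intro continuous_at_imp_continuous_on) (auto intro: has_vector_derivative_continuous)
    moreover have "continuous_on {0..t} (\<lambda>s. T s u)"
      by (rule continuous_on_subset[OF T_continuous]) auto
    ultimately show "continuous_on {0..t} f"
      unfolding f_def by (rule bounded_bilinear.continuous_on[OF bounded_bilinear_scaleC])
    show "norm (- (e s *\<^sub>C T s g)) \<le> M * norm g" if "0 < s" "s < t" for s
      using M[of s g] that by (simp add: norm_scaleC ce)
  qed (use df in auto)
  moreover have "f 0 = u" by (simp add: f_def e_def)
  moreover have "norm (f t) = norm (T t u)" by (simp add: f_def norm_scaleC ce)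
  ultimately show ?thesis
    using norm_triangle_ineq3[of "f t" u] by (simp add: g_def mult_ac)
qed

text \<open>In \<open>\<i>\<eta> T t u = T t (A u + \<i>\<eta>u) - A (T t u)\<close> the time \<open>t\<close> is so chosen, of order
  \<open>\<bar>\<eta>\<bar> powr (- \<beta>)\<close>, that the last term is at most a quarter of \<open>\<bar>\<eta>\<bar> * norm u\<close>.\<close>

lemma resolvent_decay_of_crandall_pazy:
  assumes cp: "crandall_pazy T A \<beta>" and \<beta>: "0 < \<beta>" "\<beta> \<le> 1"
  shows "resolvent_decay \<beta>"
proof -
  have inD: "T t x \<in> D" if "t > 0" for t x
    using cp that by (auto simp: crandall_pazy_def intro: D_of_differentiable)
  have "(\<lambda>t. onorm (\<lambda>x. A (T t x))) \<in> O[at_right 0](\<lambda>t. t powr (- 1 / \<beta>))"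
    using cp by (simp add: crandall_pazy_def)
  then obtain C where C: "C > 0" and
    "eventually (\<lambda>t. norm (onorm (\<lambda>x. A (T t x))) \<le> C * norm (t powr (- 1 / \<beta>))) (at_right 0)"
    by (elim landau_o.bigE)
  then obtain b where b: "b > 0" and
    "\<And>t. 0 < t \<Longrightarrow> t < b \<Longrightarrow> norm (onorm (\<lambda>x. A (T t x))) \<le> C * norm (t powr (- 1 / \<beta>))"
    by (auto simp: eventually_at_right_field)
  then have AT: "norm (A (T t x)) \<le> C * t powr (- 1 / \<beta>) * norm x" if "0 < t" "t < b" for t x
  proof -
    have "norm (A (T t x)) \<le> onorm (\<lambda>x. A (T t x)) * norm x"
      using that inD by (intro onorm A_T_bounded_linear) auto
    also have "\<dots> \<le> C * t powr (- 1 / \<beta>) * norm x"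
      using that \<open>\<And>t. 0 < t \<Longrightarrow> t < b \<Longrightarrow> norm (onorm (\<lambda>x. A (T t x))) \<le> C * norm (t powr (- 1 / \<beta>))\<close>[of t]
      by (intro mult_right_mono) auto
    finally show ?thesis .
  qed
  obtain M where M: "M \<ge> 1" "\<And>s x. 0 \<le> s \<Longrightarrow> s \<le> b \<Longrightarrow> norm (T s x) \<le> M * norm x"
    using T_locally_bounded[of b] by (metis atLeastAtMost_iff)
  define r where "r = max 1 (4 * C * b powr (- 1 / \<beta>) + 1)"
  define K where "K = 4 / 3 * M * (1 + (4 * C) powr \<beta>)"
  have "norm u \<le> K * \<bar>\<eta>\<bar> powr (- \<beta>) * norm (A u + (\<i> * of_real \<eta>) *\<^sub>C u)"
    if u: "u \<in> D" and \<eta>: "\<bar>\<eta>\<bar> \<ge> r" for \<eta> u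
  proof -
    define g where "g = A u + (\<i> * of_real \<eta>) *\<^sub>C u"
    define l where "l = \<bar>\<eta>\<bar>"
    have l: "l \<ge> 1" "l > 4 * C * b powr (- 1 / \<beta>)" using \<eta> by (auto simp: r_def l_def)
    define t where "t = (4 * C / l) powr \<beta>"
    have t0: "t > 0" using C l by (simp add: t_def)
    have "4 * C / l < b powr (1 / \<beta>)"
      using l b by (simp add: powr_minus field_simps)
    then have "t < (b powr (1 / \<beta>)) powr \<beta>"
      unfolding t_def using \<beta> C l by (intro powr_less_mono2) auto
    then have tb: "t < b" using b \<beta> by (simp add: powr_powr)
    have "C * t powr (- 1 / \<beta>) = C * (4 * C / l) powr (- 1)"
      using \<beta> by (simp add: t_def powr_powr)
    also have "\<dots> = l / 4" using C l by (simp add: powr_minus_divide)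
    finally have Ct: "C * t powr (- 1 / \<beta>) = l / 4" .
    have "(\<i> * of_real \<eta>) *\<^sub>C T t u = T t g - A (T t u)"
      using t0 u by (simp add: g_def T_plus T_scaleC T_D)
    then have "l * norm (T t u) = norm (T t g - A (T t u))"
      by (metis l_def norm_scaleC norm_mult norm_ii mult_1 norm_of_real)
    also have "\<dots> \<le> M * norm g + l / 4 * norm u"
      using norm_triangle_ineq4[of "T t g" "A (T t u)"] M(2)[of t g] AT[OF t0 tb, of u] t0 tb
      unfolding Ct by linarith
    finally have "l * norm (T t u) \<le> M * norm g + l / 4 * norm u" .
    moreover have "l * (norm u - t * M * norm g) \<le> l * norm (T t u)"
      using orbit_approx[OF u, of t M \<eta>] M(2) t0 tb l by (intro mult_left_mono) (auto simp: g_def)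
    ultimately have "3 / 4 * (l * norm u) \<le> M * norm g * (1 + l * t)" by (simp add: algebra_simps)
    then have "norm u \<le> 4 / 3 * (M * norm g * (1 / l + t))" using l by (simp add: field_simps)
    also have "\<dots> \<le> 4 / 3 * (M * norm g * ((1 + (4 * C) powr \<beta>) * l powr (- \<beta>)))"
    proof (intro mult_left_mono)
      have "1 / l \<le> l powr (- \<beta>)"
        using l \<beta> powr_mono[of "- 1" "- \<beta>" l] by (simp add: powr_minus_divide)
      moreover have "t = (4 * C) powr \<beta> * l powr (- \<beta>)"
        using C l by (simp add: t_def powr_divide powr_minus_divide)
      ultimately show "1 / l + t \<le> (1 + (4 * C) powr \<beta>) * l powr (- \<beta>)" by (simp add: algebra_simps)
      show "0 \<le> M * norm g" using M(1) by simp
    qed simp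
    finally show ?thesis by (simp only: K_def g_def l_def mult_ac)
  qed
  moreover have "K > 0" using M(1) C by (simp add: K_def add_pos_nonneg)
  moreover have "r \<ge> 1" by (simp add: r_def)
  ultimately show ?thesis unfolding resolvent_decay_def by blast
qed

lemma resolvent_bound_pointwise:
  assumes "z \<in> resolvent_set D A"
  shows "\<exists>c>0. \<forall>u\<in>D. norm u \<le> c * norm (A u - z *\<^sub>C u)"
proof -
  have bij: "bij_betw (\<lambda>x. z *\<^sub>C x - A x) D UNIV" and bl: "bounded_linear (resolvent D A z)"
    using assms by (auto simp: resolvent_set_def bounded_clinear_def)
  obtain c where c: "c > 0" "\<And>x. norm (resolvent D A z x) \<le> norm x * c"
    using bounded_linear.pos_bounded[OF bl] by blast
  have "norm u \<le> c * norm (A u - z *\<^sub>C u)" if "u \<in> D" for u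
  proof -
    have "resolvent D A z (z *\<^sub>C u - A u) = u"
      unfolding resolvent_def using bij_betw_inv_into_left[OF bij that] .
    then show ?thesis using c(2)[of "z *\<^sub>C u - A u"] by (simp add: norm_minus_commute mult.commute)
  qed
  then show ?thesis using c(1) by blast
qed

text \<open>Around each frequency a lower bound persists, with half the constant, so that compactness gives
  a common bound on an interval.\<close>

lemma resolvent_bound_interval:
  assumes spec: "\<And>\<eta>. \<i> * of_real \<eta> \<in> resolvent_set D A" and ab: "a \<le> b"
  shows "\<exists>c. \<forall>\<eta>\<in>{a..b}. \<forall>u\<in>D. norm u \<le> c * norm (A u + (\<i> * of_real \<eta>) *\<^sub>C u)"
  using ab
proof (induction rule: Bolzano)
  case (trans a b c)
  then obtain c1 c2 where
    c1: "\<forall>\<eta>\<in>{a..b}. \<forall>u\<in>D. norm u \<le> c1 * norm (A u + (\<i> * of_real \<eta>) *\<^sub>C u)" and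
    c2: "\<forall>\<eta>\<in>{b..c}. \<forall>u\<in>D. norm u \<le> c2 * norm (A u + (\<i> * of_real \<eta>) *\<^sub>C u)" by blast
  have "norm u \<le> max c1 c2 * norm (A u + (\<i> * of_real \<eta>) *\<^sub>C u)" if "\<eta> \<in> {a..c}" "u \<in> D" for \<eta> u
  proof (cases "\<eta> \<le> b")
    case True
    then have "norm u \<le> c1 * norm (A u + (\<i> * of_real \<eta>) *\<^sub>C u)" using c1 that by auto
    also have "\<dots> \<le> max c1 c2 * norm (A u + (\<i> * of_real \<eta>) *\<^sub>C u)" by (intro mult_right_mono) auto
    finally show ?thesis .
  next
    case False
    then have "norm u \<le> c2 * norm (A u + (\<i> * of_real \<eta>) *\<^sub>C u)" using c2 that by auto
    also have "\<dots> \<le> max c1 c2 * norm (A u + (\<i> * of_real \<eta>) *\<^sub>C u)" by (intro mult_right_mono) auto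
    finally show ?thesis .
  qed
  then show ?case by blast
next
  case (local \<eta>0)
  obtain c where c: "c > 0" "\<And>u. u \<in> D \<Longrightarrow> norm u \<le> c * norm (A u + (\<i> * of_real \<eta>0) *\<^sub>C u)"
    using resolvent_bound_pointwise[OF spec[of "- \<eta>0"]] by (auto simp: scaleC_minus_left)
  have main: "norm u \<le> 2 * c * norm (A u + (\<i> * of_real \<eta>) *\<^sub>C u)"
    if "\<bar>\<eta> - \<eta>0\<bar> \<le> 1 / (2 * c)" "u \<in> D" for \<eta> u
  proof -
    have eq: "A u + (\<i> * of_real \<eta>0) *\<^sub>C u
        = (A u + (\<i> * of_real \<eta>) *\<^sub>C u) - (\<i> * of_real (\<eta> - \<eta>0)) *\<^sub>C u"
      by (simp add: algebra_simps scaleC_diff_left)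
    have "norm (A u + (\<i> * of_real \<eta>0) *\<^sub>C u)
        \<le> norm (A u + (\<i> * of_real \<eta>) *\<^sub>C u) + \<bar>\<eta> - \<eta>0\<bar> * norm u"
      using norm_triangle_ineq4[of "A u + (\<i> * of_real \<eta>) *\<^sub>C u" "(\<i> * of_real (\<eta> - \<eta>0)) *\<^sub>C u"]
      unfolding eq by (simp add: norm_scaleC norm_mult del: of_real_diff)
    also have "\<dots> \<le> norm (A u + (\<i> * of_real \<eta>) *\<^sub>C u) + 1 / (2 * c) * norm u"
      using that by (intro add_left_mono mult_right_mono) auto
    finally have "c * norm (A u + (\<i> * of_real \<eta>0) *\<^sub>C u)
        \<le> c * (norm (A u + (\<i> * of_real \<eta>) *\<^sub>C u) + 1 / (2 * c) * norm u)"
      using c(1) by (intro mult_left_mono) auto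
    also have "\<dots> = c * norm (A u + (\<i> * of_real \<eta>) *\<^sub>C u) + norm u / 2"
      using c(1) by (simp add: field_simps)
    finally show ?thesis using c(2)[OF that(2)] by linarith
  qed
  show ?case
  proof (rule exI[of _ "1 / (2 * c)"], intro conjI allI impI)
    fix a b assume "a \<le> \<eta>0 \<and> \<eta>0 \<le> b \<and> b - a < 1 / (2 * c)"
    then show "\<exists>c. \<forall>\<eta>\<in>{a..b}. \<forall>u\<in>D. norm u \<le> c * norm (A u + (\<i> * of_real \<eta>) *\<^sub>C u)"
      using main by (intro exI[of _ "2 * c"]) (auto simp: abs_le_iff)
  qed (use c in auto)
qed

lemma resolvent_decay_global:
  assumes rd: "resolvent_decay \<beta>" and \<beta>: "\<beta> > 0"
    and spec: "\<And>\<eta>. \<i> * of_real \<eta> \<in> resolvent_set D A"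
  shows "\<exists>C>0. \<forall>\<eta> u. u \<in> D \<longrightarrow>
      norm u \<le> C * (1 + \<bar>\<eta>\<bar>) powr (- \<beta>) * norm (A u + (\<i> * of_real \<eta>) *\<^sub>C u)"
proof -
  obtain C r where C: "C > 0" and r: "r \<ge> 1" and
    bd: "\<And>\<eta> u. u \<in> D \<Longrightarrow> \<bar>\<eta>\<bar> \<ge> r \<Longrightarrow> norm u \<le> C * \<bar>\<eta>\<bar> powr (- \<beta>) * norm (A u + (\<i> * of_real \<eta>) *\<^sub>C u)"
    using rd by (auto simp: resolvent_decay_def)
  have "- r \<le> r" using r by simp
  from resolvent_bound_interval[OF spec this]
  obtain c where c: "\<forall>\<eta>\<in>{- r..r}. \<forall>u\<in>D. norm u \<le> c * norm (A u + (\<i> * of_real \<eta>) *\<^sub>C u)" ..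
  define K where "K = C * 2 powr \<beta> + \<bar>c\<bar> * (1 + r) powr \<beta>"
  have K: "K > 0" using C by (simp add: K_def add_pos_nonneg)
  have "norm u \<le> K * (1 + \<bar>\<eta>\<bar>) powr (- \<beta>) * norm (A u + (\<i> * of_real \<eta>) *\<^sub>C u)" if u: "u \<in> D" for \<eta> u
  proof (cases "\<bar>\<eta>\<bar> \<ge> r")
    case True
    have "norm u \<le> C * \<bar>\<eta>\<bar> powr (- \<beta>) * norm (A u + (\<i> * of_real \<eta>) *\<^sub>C u)" by (rule bd[OF u True])
    also have "\<dots> \<le> K * (1 + \<bar>\<eta>\<bar>) powr (- \<beta>) * norm (A u + (\<i> * of_real \<eta>) *\<^sub>C u)"
    proof (rule mult_right_mono)
      have "\<bar>\<eta>\<bar> powr (- \<beta>) \<le> ((1 + \<bar>\<eta>\<bar>) / 2) powr (- \<beta>)"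
        using True r \<beta> by (intro powr_mono2') auto
      also have "\<dots> = 2 powr \<beta> * (1 + \<bar>\<eta>\<bar>) powr (- \<beta>)"
        by (simp add: powr_divide powr_minus_divide)
      finally have "C * \<bar>\<eta>\<bar> powr (- \<beta>) \<le> C * 2 powr \<beta> * (1 + \<bar>\<eta>\<bar>) powr (- \<beta>)"
        using C by simp
      also have "\<dots> \<le> K * (1 + \<bar>\<eta>\<bar>) powr (- \<beta>)"
        by (intro mult_right_mono) (auto simp: K_def)
      finally show "C * \<bar>\<eta>\<bar> powr (- \<beta>) \<le> K * (1 + \<bar>\<eta>\<bar>) powr (- \<beta>)" .
    qed simp
    finally show ?thesis .
  next
    case False
    then have "\<eta> \<in> {- r..r}" by (simp add: abs_le_iff not_le) linarith
    then have "norm u \<le> c * norm (A u + (\<i> * of_real \<eta>) *\<^sub>C u)" using c u by blast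
    also have "\<dots> \<le> K * (1 + \<bar>\<eta>\<bar>) powr (- \<beta>) * norm (A u + (\<i> * of_real \<eta>) *\<^sub>C u)"
    proof (rule mult_right_mono)
      have "c \<le> \<bar>c\<bar> * ((1 + r) powr \<beta> * (1 + r) powr (- \<beta>))"
        using r by (simp add: powr_minus_divide)
      also have "\<dots> \<le> \<bar>c\<bar> * ((1 + r) powr \<beta> * (1 + \<bar>\<eta>\<bar>) powr (- \<beta>))"
        using False \<beta> by (intro mult_left_mono powr_mono2') auto
      also have "\<dots> \<le> K * (1 + \<bar>\<eta>\<bar>) powr (- \<beta>)"
        unfolding mult.assoc[symmetric] using C by (intro mult_right_mono) (auto simp: K_def)
      finally show "c \<le> K * (1 + \<bar>\<eta>\<bar>) powr (- \<beta>)" .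
    qed simp
    finally show ?thesis .
  qed
  then show ?thesis using K by blast
qed

end

context cayley_setting
begin

text \<open>For \<open>z \<noteq> 1\<close> on the unit circle, \<open>z - V\<close> is a multiple of \<open>(A + \<i>\<eta>) (A + w)\<^sup>-\<^sup>1\<close>, where
  \<open>\<i>\<eta> = w (z + 1) / (z - 1)\<close>.\<close>

lemma V_shift:
  assumes u: "u \<in> D" and z: "(z - 1) * (\<i> * of_real \<eta>) = of_real w * (z + 1)"
  defines "x \<equiv> w *\<^sub>R u + A u"
  shows "z *\<^sub>C x - V x = (z - 1) *\<^sub>C (A u + (\<i> * of_real \<eta>) *\<^sub>C u)"
proof -
  have Sx: "S x = u" unfolding x_def by (rule S_left[OF u])
  have "(z - 1) *\<^sub>C (A u + (\<i> * of_real \<eta>) *\<^sub>C u) = (z - 1) *\<^sub>C A u + (of_real w * (z + 1)) *\<^sub>C u"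
    by (simp only: scaleC_add_right scaleC_scaleC z)
  also have "(of_real w * (z + 1)) *\<^sub>C u = z *\<^sub>C (w *\<^sub>R u) + w *\<^sub>R u"
    by (simp add: distrib_left scaleC_add_left scaleC_of_real mult.commute[of _ z]
      flip: scaleC_scaleC)
  finally show ?thesis
    by (simp add: V_eq Sx) (simp add: x_def scaleC_diff_left scaleC_add_right algebra_simps
      flip: scaleR_add_left)
qed

text \<open>Since \<open>\<bar>\<eta>\<bar>\<close> is of order \<open>1 / cmod (1 - z)\<close> near \<open>z = 1\<close>, decay of order \<open>\<beta>\<close> for \<open>A\<close> at infinity
  corresponds to growth of order \<open>2 - \<beta>\<close> for the resolvent of \<open>V\<close> at \<open>1\<close>: one power comes from the
  factor \<open>z - 1\<close>, and \<open>1 - \<beta>\<close> from \<open>(A + w) (A + \<i>\<eta>)\<^sup>-\<^sup>1 = 1 + (w - \<i>\<eta>) (A + \<i>\<eta>)\<^sup>-\<^sup>1\<close>.\<close>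

lemma cayley_resolvent_bound:
  assumes rd: "resolvent_decay \<beta>" and \<beta>: "0 < \<beta>" "\<beta> \<le> 1"
    and spec: "\<And>\<eta>. \<i> * of_real \<eta> \<in> resolvent_set D A"
  shows "\<exists>C\<ge>0. \<forall>z x. cmod z = 1 \<longrightarrow> z \<noteq> 1 \<longrightarrow>
      norm x \<le> C * cmod (1 - z) powr (- (2 - \<beta>)) * norm (z *\<^sub>C x - V x)"
proof -
  obtain C where C: "C > 0" and
    bd: "\<And>\<eta> u. u \<in> D \<Longrightarrow> norm u \<le> C * (1 + \<bar>\<eta>\<bar>) powr (- \<beta>) * norm (A u + (\<i> * of_real \<eta>) *\<^sub>C u)"
    using resolvent_decay_global[OF rd \<beta>(1) spec] by blast
  define L where "L = 1 + (w + 1) * C"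
  define K where "K = L * (2 + 2 * w) powr (1 - \<beta>)"
  have L: "L \<ge> 0" using C w_pos by (simp add: L_def)
  have "norm x \<le> K * cmod (1 - z) powr (- (2 - \<beta>)) * norm (z *\<^sub>C x - V x)"
    if z: "cmod z = 1" "z \<noteq> 1" for z x
  proof -
    define d where "d = cmod (1 - z)"
    have d: "d > 0" "d \<le> 2" using z norm_triangle_ineq4[of 1 z] by (auto simp: d_def)
    define \<eta> where "\<eta> = Im (of_real w * (z + 1) / (z - 1))"
    have "Re (of_real w * (z + 1) / (z - 1)) = 0"
    proof -
      have "Re ((z + 1) * cnj (z - 1)) = 0"
        using z(1) by (simp add: cmod_def algebra_simps power2_eq_square)
      then have "Re ((z + 1) / (z - 1)) = 0"
        by (simp add: complex_div_cnj[of "z + 1"] flip: complex_norm_square of_real_power)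
      then show ?thesis by (simp flip: times_divide_eq_right)
    qed
    then have i\<eta>: "\<i> * of_real \<eta> = of_real w * (z + 1) / (z - 1)"
      by (simp add: \<eta>_def complex_eq_iff)
    then have z\<eta>: "(z - 1) * (\<i> * of_real \<eta>) = of_real w * (z + 1)" using z by simp
    have "\<bar>\<eta>\<bar> = cmod (\<i> * of_real \<eta>)" by (simp add: norm_mult)
    also have "\<dots> = w * cmod (z + 1) / d"
      using w_pos by (simp add: i\<eta> norm_mult norm_divide d_def norm_minus_commute)
    also have "\<dots> \<le> w * 2 / d"
      using z(1) w_pos d norm_triangle_ineq[of z 1] by (intro divide_right_mono mult_left_mono) auto
    finally have \<eta>d: "1 + \<bar>\<eta>\<bar> \<le> (2 + 2 * w) / d" using d by (simp add: field_simps)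
    define u where "u = S x"
    have u: "u \<in> D" by (simp add: u_def S_D)
    have xu: "x = w *\<^sub>R u + A u" by (simp add: u_def S_right)
    define g where "g = A u + (\<i> * of_real \<eta>) *\<^sub>C u"
    have g: "d * norm g = norm (z *\<^sub>C x - V x)"
      unfolding xu V_shift[OF u z\<eta>] by (simp add: norm_scaleC g_def d_def norm_minus_commute)
    have "x = g + w *\<^sub>R u - (\<i> * of_real \<eta>) *\<^sub>C u" by (simp add: xu g_def)
    then have "norm x \<le> norm g + norm (w *\<^sub>R u) + norm ((\<i> * of_real \<eta>) *\<^sub>C u)"
      by (metis norm_triangle_ineq norm_triangle_ineq4 add_right_mono order_trans)
    also have "\<dots> = norm g + (w + \<bar>\<eta>\<bar>) * norm u"
      using w_pos by (simp add: norm_scaleC norm_mult algebra_simps)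
    also have "\<dots> \<le> norm g + ((w + 1) * (1 + \<bar>\<eta>\<bar>)) * (C * (1 + \<bar>\<eta>\<bar>) powr (- \<beta>) * norm g)"
      using bd[OF u, of \<eta>] w_pos by (intro add_left_mono mult_mono) (auto simp: g_def algebra_simps)
    also have "\<dots> = norm g + (w + 1) * C * ((1 + \<bar>\<eta>\<bar>) powr (1 - \<beta>) * norm g)"
      by (simp add: powr_diff powr_minus divide_inverse mult_ac)
    also have "\<dots> \<le> L * ((1 + \<bar>\<eta>\<bar>) powr (1 - \<beta>) * norm g)"
    proof -
      have "1 * norm g \<le> (1 + \<bar>\<eta>\<bar>) powr (1 - \<beta>) * norm g"
        using \<beta> by (intro mult_right_mono ge_one_powr_ge_zero) auto
      then show ?thesis by (simp add: L_def distrib_right)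
    qed
    also have "\<dots> \<le> L * (((2 + 2 * w) / d) powr (1 - \<beta>) * norm g)"
      using \<beta> \<eta>d L by (intro mult_left_mono mult_right_mono powr_mono2) auto
    also have "\<dots> = K * (d powr (- (1 - \<beta>)) * norm g)"
      using d w_pos by (simp add: K_def powr_divide powr_minus_divide del: minus_diff_eq)
    also have "d powr (- (1 - \<beta>)) * norm g = d powr (- (2 - \<beta>)) * (d * norm g)"
      using d by (simp add: powr_diff power2_eq_square)
    finally show ?thesis unfolding g by (simp add: d_def)
  qed
  moreover have "K \<ge> 0" using L by (simp add: K_def)
  ultimately show ?thesis by blast
qed

lemma resolvent_decay_of_cayley:
  assumes K: "K \<ge> 0" and \<delta>: "\<delta> > 0" and \<beta>: "0 < \<beta>" "\<beta> \<le> 1"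
    and bd: "\<And>z x. cmod z = 1 \<Longrightarrow> z \<noteq> 1 \<Longrightarrow> cmod (1 - z) \<le> \<delta> \<Longrightarrow>
      norm x \<le> K * cmod (1 - z) powr (- (2 - \<beta>)) * norm (z *\<^sub>C x - V x)"
  shows "resolvent_decay \<beta>"
proof -
  define r where "r = max 1 (max w (2 * w / \<delta>))"
  define C where "C = 1 + K * w powr (\<beta> - 1)"
  have "norm u \<le> C * \<bar>\<eta>\<bar> powr (- \<beta>) * norm (A u + (\<i> * of_real \<eta>) *\<^sub>C u)"
    if u: "u \<in> D" and \<eta>: "\<bar>\<eta>\<bar> \<ge> r" for \<eta> u
  proof -
    define l where "l = \<bar>\<eta>\<bar>"
    have l: "l \<ge> 1" "l \<ge> w" "l \<ge> 2 * w / \<delta>" using \<eta> by (auto simp: r_def l_def)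
    define p where "p = \<i> * complex_of_real \<eta>"
    \<comment> \<open>the solution of \<open>\<i>\<eta> = w (z + 1) / (z - 1)\<close>\<close>
    define z where "z = (p + w) / (p - w)"
    have pw: "p - w \<noteq> 0" using w_pos by (simp add: p_def complex_eq_iff)
    have "cmod (p + w) = cmod (p - w)" by (simp add: p_def cmod_def)
    then have z1: "cmod z = 1" using pw by (simp add: z_def norm_divide)
    have zm: "z - 1 = 2 * w / (p - w)" using pw by (simp add: z_def field_simps)
    have z\<eta>: "(z - 1) * (\<i> * of_real \<eta>) = of_real w * (z + 1)"
      using pw unfolding p_def[symmetric] by (simp add: z_def field_simps)
    define d where "d = cmod (1 - z)"
    have dd: "d = 2 * w / cmod (p - w)"
      using w_pos by (simp add: d_def norm_minus_commute[of 1] zm norm_divide norm_mult)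
    have pl: "l \<le> cmod (p - w)" "cmod (p - w) \<le> 2 * l"
      using abs_Im_le_cmod[of "p - w"] norm_triangle_ineq4[of p "of_real w"] l w_pos
      by (auto simp: p_def l_def norm_mult)
    have d: "d \<ge> w / l" "d \<le> \<delta>" "d > 0"
    proof -
      have pos0: "0 < l" "0 < cmod (p - w)" using pl l by linarith+
      then have pos: "0 < l * cmod (p - w)" by (rule mult_pos_pos)
      have "w / l = 2 * w / (2 * l)" by simp
      also have "\<dots> \<le> d" unfolding dd using pl l w_pos pos by (intro divide_left_mono) (auto simp: mult_ac)
      finally show "d \<ge> w / l" .
      have "d \<le> 2 * w / l" unfolding dd using pl l w_pos pos by (intro divide_left_mono) (auto simp: mult_ac)
      also have "\<dots> \<le> \<delta>" using l \<delta> by (simp add: field_simps)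
      finally show "d \<le> \<delta>" .
      show "d > 0" unfolding dd using pos0(2) by (rule divide_pos_pos[rotated]) (use w_pos in simp)
    qed
    then have zn1: "z \<noteq> 1" by (auto simp: d_def)
    define x where "x = w *\<^sub>R u + A u"
    define g where "g = A u + (\<i> * of_real \<eta>) *\<^sub>C u"
    have "norm x \<le> K * d powr (- (2 - \<beta>)) * norm (z *\<^sub>C x - V x)"
      using bd[OF z1 zn1] d by (simp add: d_def)
    also have "norm (z *\<^sub>C x - V x) = d * norm g"
      unfolding x_def V_shift[OF u z\<eta>] by (simp add: norm_scaleC g_def d_def norm_minus_commute)
    also have "K * d powr (- (2 - \<beta>)) * (d * norm g) = K * (d powr (\<beta> - 1) * norm g)"
      using d by (simp add: powr_diff power2_eq_square)
    also have "\<dots> \<le> K * ((w / l) powr (\<beta> - 1) * norm g)"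
      using K d l w_pos \<beta> by (intro mult_left_mono mult_right_mono powr_mono2') auto
    also have "(w / l) powr (\<beta> - 1) = w powr (\<beta> - 1) * l powr (1 - \<beta>)"
      using l w_pos by (simp add: powr_divide powr_diff)
    finally have x: "norm x \<le> K * w powr (\<beta> - 1) * (l powr (1 - \<beta>) * norm g)" by (simp add: mult_ac)
    have "(p - w) *\<^sub>C u = g - x"
      by (simp add: x_def g_def p_def scaleC_diff_left scaleC_of_real)
    then have "cmod (p - w) * norm u \<le> norm g + norm x"
      by (metis norm_scaleC norm_triangle_ineq4)
    moreover have "l * norm u \<le> cmod (p - w) * norm u" using pl by (intro mult_right_mono) auto
    moreover have "1 * norm g \<le> l powr (1 - \<beta>) * norm g"
      using \<beta> l by (intro mult_right_mono ge_one_powr_ge_zero) auto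
    ultimately have "l * norm u \<le> C * (l powr (1 - \<beta>) * norm g)"
      using x by (simp add: C_def distrib_right)
    then have "norm u \<le> C * (l powr (1 - \<beta>) * norm g) / l" using l by (simp add: field_simps)
    also have "\<dots> = C * l powr (- \<beta>) * norm g"
      using l by (simp add: powr_diff powr_minus_divide)
    finally show ?thesis by (simp add: l_def g_def)
  qed
  moreover have "C > 0" using K by (simp add: C_def add_pos_nonneg)
  moreover have "r \<ge> 1" by (simp add: r_def)
  ultimately show ?thesis unfolding resolvent_decay_def by blast
qed

end

section \<open>From resolvent decay to the Crandall-Pazy class\<close>

lemma root_power_dvd_pderiv:
  fixes p :: "'a::idom poly"
  assumes "b ^ Suc k dvd p"
  shows "b ^ k dvd pderiv p"
proof -
  obtain q where q: "p = b ^ Suc k * q" using assms by blast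
  have "pderiv p = b ^ k * (b * pderiv q + smult (of_nat (Suc k)) (pderiv b * q))"
    unfolding q pderiv_mult pderiv_power_Suc by (simp add: algebra_simps)
  then show ?thesis by simp
qed

text \<open>A bump function \<open>\<phi> 0\<close> supported in \<open>{1..2}\<close>, with its bounded derivatives
  \<open>\<phi> 1, \<dots>, \<phi> (m + 1)\<close>: a power of \<open>(s - 1) * (2 - s)\<close>, cut off outside \<open>{1..2}\<close>.\<close>

lemma bump_exists:
  fixes m :: nat
  obtains \<phi> :: "nat \<Rightarrow> real \<Rightarrow> real" and c :: real
  where "\<And>i s. i \<le> m \<Longrightarrow> (\<phi> i has_real_derivative \<phi> (Suc i) s) (at s)"
    and "\<And>i s. s \<notin> {1..2} \<Longrightarrow> \<phi> i s = 0"
    and "\<And>i s. i \<le> Suc m \<Longrightarrow> \<bar>\<phi> i s\<bar> \<le> c"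
    and "\<And>s. 5/4 \<le> s \<Longrightarrow> s \<le> 7/4 \<Longrightarrow> \<phi> 0 s \<ge> 1"
proof -
  \<comment> \<open>\<open>b = 16 / 3 * (s - 1) * (2 - s)\<close>, normalised to the value \<open>1\<close> at \<open>5 / 4\<close> and \<open>7 / 4\<close>\<close>
  define b :: "real poly" where "b = [:- 32/3, 16, - 16/3:]"
  have b0: "poly b 1 = 0" "poly b 2 = 0" by (simp_all add: b_def)
  define q where "q = (\<lambda>i. (pderiv ^^ i) (b ^ (m + 2)))"
  define \<phi> where "\<phi> = (\<lambda>i s. if s \<in> {1..2} then poly (q i) s else 0)"
  have dvd: "b ^ (m + 2 - i) dvd q i" if "i \<le> m + 2" for i
    using that
  proof (induction i)
    case (Suc i)
    have "Suc (m + 2 - Suc i) = m + 2 - i" using Suc.prems by simp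
    then have "b ^ Suc (m + 2 - Suc i) dvd q i" using Suc.IH Suc.prems by (simp only: Suc_leD)
    then show ?case unfolding q_def by (simp only: funpow.simps comp_apply root_power_dvd_pderiv)
  qed (simp add: q_def)
  have q0: "poly (q i) 1 = 0" "poly (q i) 2 = 0" if "i \<le> Suc m" for i
  proof -
    have "b dvd b ^ (m + 2 - i)" using that by (intro dvd_power) auto
    then have "b dvd q i" using dvd_trans[OF _ dvd[of i]] that by simp
    then show "poly (q i) 1 = 0" "poly (q i) 2 = 0" using b0 by (auto elim!: dvdE)
  qed
  have deriv: "(\<phi> i has_real_derivative \<phi> (Suc i) s) (at s)" if i: "i \<le> m" for i s
  proof -
    have closures: "closure (- {1..2::real}) = {..1} \<union> {2..}"
    proof -
      have "- {1..2::real} = {..<1} \<union> {2<..}" by auto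
      then show ?thesis by (simp add: closure_Un)
    qed
    have "((\<lambda>s. if s \<in> {1..2} then poly (q i) s else 0) has_vector_derivative
        (if s \<in> {1..2} then poly (q (Suc i)) s else 0)) (at s within UNIV)"
    proof (rule has_vector_derivative_If_within_closures[where T = "- {1..2}"])
      show "(poly (q i) has_vector_derivative poly (q (Suc i)) s) (at s within S)" for S
        unfolding has_real_derivative_iff_has_vector_derivative[symmetric]
        by (rule DERIV_subset[OF poly_DERIV, THEN DERIV_cong]) (simp_all add: q_def)
    next
      assume s: "s \<in> closure {1..2}" "s \<in> closure (- {1..2})"
      then have "s = 1 \<or> s = 2" unfolding closures by auto
      then show "poly (q i) s = 0" "poly (q (Suc i)) s = 0" using q0 i by auto
    qed auto
    then show ?thesis
      by (simp add: \<phi>_def has_real_derivative_iff_has_vector_derivative)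
  qed
  have "\<exists>c. \<forall>s. \<bar>\<phi> i s\<bar> \<le> c" for i
  proof -
    have "bounded (poly (q i) ` {1..2})"
      by (intro compact_imp_bounded compact_continuous_image continuous_intros) auto
    then obtain c where "\<forall>s\<in>{1..2}. \<bar>poly (q i) s\<bar> \<le> c"
      by (auto simp: bounded_iff)
    then have "\<bar>\<phi> i s\<bar> \<le> max c 0" for s by (auto simp: \<phi>_def le_max_iff_disj)
    then show ?thesis by blast
  qed
  then obtain c where c: "\<And>i s. \<bar>\<phi> i s\<bar> \<le> c i" by metis
  show ?thesis
  proof (rule that[of \<phi> "MAX i\<in>{..Suc m}. c i"])
    show "(\<phi> i has_real_derivative \<phi> (Suc i) s) (at s)" if "i \<le> m" for i s
      by (rule deriv[OF that])
    show "\<bar>\<phi> i s\<bar> \<le> (MAX i\<in>{..Suc m}. c i)" if "i \<le> Suc m" for i s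
      using c[of i s] that by (intro order_trans[OF _ Max_ge]) auto
    show "\<phi> 0 s \<ge> 1" if "5/4 \<le> s" "s \<le> 7/4" for s
    proof -
      have "0 \<le> (s - 5/4) * (7/4 - s)" using that by simp
      then have "poly b s \<ge> 1" by (simp add: b_def algebra_simps)
      then have "poly (b ^ (m + 2)) s \<ge> 1" unfolding poly_power by (rule one_le_power)
      moreover have "\<phi> 0 s = poly (b ^ (m + 2)) s" using that unfolding \<phi>_def q_def by simp
      ultimately show ?thesis by (simp only:)
    qed
  qed (auto simp: \<phi>_def)
qed

lemma central_difference_bound:
  fixes f :: "real \<Rightarrow> 'a::real_normed_vector"
  assumes f: "\<And>s. (f has_vector_derivative f' s) (at s)"
    and L: "\<And>r s. norm (f' r - f' s) \<le> L * \<bar>r - s\<bar>" and h: "h > 0" and L0: "L \<ge> 0"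
  shows "norm ((f (s + h) - f (s - h)) /\<^sub>R (2 * h) - f' s) \<le> L * h"
proof -
  define g where "g = (\<lambda>r. f r - r *\<^sub>R f' s)"
  have g: "(g has_vector_derivative f' r - f' s) (at r)" for r
    unfolding g_def by (auto intro!: derivative_eq_intros f)
  have "norm (g (s + h) - g (s - h)) \<le> L * h * ((s + h) - (s - h))"
  proof (rule mean_value_inequality[OF _ _ g])
    show "continuous_on {s - h..s + h} g"
      using g by (intro continuous_at_imp_continuous_on) (auto intro: has_vector_derivative_continuous)
    show "norm (f' r - f' s) \<le> L * h" if "s - h < r" "r < s + h" for r
      by (rule order_trans[OF L mult_left_mono]) (use that L0 in auto)
  qed (use h in auto)
  moreover have "(f (s + h) - f (s - h)) /\<^sub>R (2 * h) - f' s = (g (s + h) - g (s - h)) /\<^sub>R (2 * h)"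
  proof -
    have "(s + h) *\<^sub>R f' s - (s - h) *\<^sub>R f' s = (2 * h) *\<^sub>R f' s"
      by (simp flip: scaleR_diff_left)
    moreover have "g (s + h) - g (s - h) = (f (s + h) - f (s - h)) - ((s + h) *\<^sub>R f' s - (s - h) *\<^sub>R f' s)"
      by (simp add: g_def)
    ultimately have "g (s + h) - g (s - h) = (f (s + h) - f (s - h)) - (2 * h) *\<^sub>R f' s" by simp
    then show ?thesis using h by (simp only: scaleR_diff_right scaleR_scaleR) simp
  qed
  moreover have "norm ((g (s + h) - g (s - h)) /\<^sub>R (2 * h)) = inverse (2 * h) * norm (g (s + h) - g (s - h))"
    using h by simp
  ultimately have "norm ((f (s + h) - f (s - h)) /\<^sub>R (2 * h) - f' s)
      \<le> inverse (2 * h) * (L * h * ((s + h) - (s - h)))"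
    using h by (simp only:) (intro mult_left_mono, auto)
  also have "\<dots> = L * h" using h by (simp add: field_simps)
  finally show ?thesis .
qed

context semigroup_generator
begin

text \<open>The key inequality at a fixed frequency. In its application the \<open>u i\<close> are the Fourier transforms of
  cut-off orbits, the \<open>e i\<close> those of discretisation errors, and \<open>h\<close> is the step size. For \<open>\<bar>\<eta>\<bar> \<le> B\<close> the term \<open>\<eta> u 0\<close> is estimated trivially,
  for \<open>\<bar>\<eta>\<bar> > B\<close> the resolvent bound is applied \<open>m\<close> times, where \<open>m \<beta> \<ge> 1\<close>.\<close>

lemma frequency_estimate:
  fixes u e :: "nat \<Rightarrow> 'a"
  assumes C: "C > 0" and \<beta>: "0 < \<beta>" "\<beta> \<le> 1" and m: "m > 0" "real m * \<beta> \<ge> 1"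
    and bound: "\<And>i. i < m \<Longrightarrow> norm (u i) \<le> C * \<bar>\<eta>\<bar> powr (- \<beta>) * norm (A (u i) + (\<i> * of_real \<eta>) *\<^sub>C u i)"
    and eq: "\<And>i. i < m \<Longrightarrow> A (u i) + (\<i> * of_real \<eta>) *\<^sub>C u i = u (Suc i) + e i"
    and \<eta>: "\<bar>\<eta>\<bar> \<ge> 1" "C * \<bar>\<eta>\<bar> powr (- \<beta>) \<le> 1" "\<bar>\<eta>\<bar> \<le> 1 / h" and h: "0 < h" "h \<le> 1"
    and B: "B > 0"
  shows "norm (A (u 0)) \<le> B * norm (u 0) + norm (u 1) + C ^ m * B powr (1 - real m * \<beta>) * norm (u m)
      + (1 + C) * h powr (\<beta> - 1) * (\<Sum>i<m. norm (e i))"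
proof -
  define l where "l = \<bar>\<eta>\<bar>"
  define \<rho> where "\<rho> = C * l powr (- \<beta>)"
  have l: "l \<ge> 1" "l \<le> 1 / h" using \<eta> by (auto simp: l_def)
  have \<rho>: "0 < \<rho>" "\<rho> \<le> 1" using C \<eta> by (auto simp: \<rho>_def l_def)
  define E where "E = (\<Sum>i<m. norm (e i))"
  have E0: "E \<ge> 0" by (simp add: E_def sum_nonneg)
  have step: "norm (u i) \<le> \<rho> * (norm (u (Suc i)) + norm (e i))" if "i < m" for i
  proof -
    have "norm (u i) \<le> \<rho> * norm (u (Suc i) + e i)"
      using bound[OF that] unfolding eq[OF that] by (simp add: \<rho>_def l_def)
    also have "\<dots> \<le> \<rho> * (norm (u (Suc i)) + norm (e i))"
      using \<rho> by (intro mult_left_mono norm_triangle_ineq) auto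
    finally show ?thesis .
  qed
  have iter: "norm (u 0) \<le> \<rho> ^ j * norm (u j) + \<rho> * (\<Sum>i<j. norm (e i))" if "j \<le> m" for j
    using that
  proof (induction j)
    case (Suc j)
    have "\<rho> ^ j * norm (u j) \<le> \<rho> ^ j * (\<rho> * (norm (u (Suc j)) + norm (e j)))"
      using step[of j] Suc.prems \<rho> by (intro mult_left_mono) auto
    moreover have "\<rho> ^ j * (\<rho> * norm (e j)) \<le> 1 * (\<rho> * norm (e j))"
      using \<rho> by (intro mult_right_mono power_le_one) auto
    ultimately show ?case using Suc by (simp add: algebra_simps)
  qed simp
  have h1: "h powr (\<beta> - 1) \<ge> 1"
    using powr_mono2'[of "\<beta> - 1" h 1] h \<beta> by simp
  have lh: "l powr (1 - \<beta>) \<le> h powr (\<beta> - 1)"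
  proof -
    have "l powr (1 - \<beta>) \<le> (1 / h) powr (1 - \<beta>)" using l \<beta> by (intro powr_mono2) auto
    also have "\<dots> = h powr (\<beta> - 1)" using h by (simp add: powr_divide powr_diff)
    finally show ?thesis .
  qed
  have e0: "norm (e 0) \<le> h powr (\<beta> - 1) * E"
  proof -
    have "norm (e 0) \<le> E"
      unfolding E_def using m by (intro member_le_sum) auto
    also have "\<dots> \<le> h powr (\<beta> - 1) * E" using mult_right_mono[OF h1 E0] by simp
    finally show ?thesis .
  qed
  have "A (u 0) = u 1 + e 0 - (\<i> * of_real \<eta>) *\<^sub>C u 0"
    using eq[of 0] m by (simp add: algebra_simps)
  then have "norm (A (u 0)) \<le> norm (u 1) + norm (e 0) + l * norm (u 0)"
    using norm_triangle_ineq4[of "u 1 + e 0" "(\<i> * of_real \<eta>) *\<^sub>C u 0"] norm_triangle_ineq[of "u 1" "e 0"]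
    by (simp add: norm_scaleC norm_mult l_def)
  moreover have "l * norm (u 0) \<le> B * norm (u 0) + C ^ m * B powr (1 - real m * \<beta>) * norm (u m)
      + C * h powr (\<beta> - 1) * E"
  proof (cases "l \<le> B")
    case True
    then have "l * norm (u 0) \<le> B * norm (u 0)" by (intro mult_right_mono) auto
    moreover have "0 \<le> C ^ m * B powr (1 - real m * \<beta>) * norm (u m)" "0 \<le> C * h powr (\<beta> - 1) * E"
      using C E0 by auto
    ultimately show ?thesis by linarith
  next
    case False
    have "l * norm (u 0) \<le> l * (\<rho> ^ m * norm (u m) + \<rho> * E)"
      using iter[of m] l by (intro mult_left_mono) (auto simp: E_def)
    also have "\<dots> = C ^ m * (l powr (1 - real m * \<beta>) * norm (u m)) + C * (l powr (1 - \<beta>) * E)"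
    proof -
      have "l * \<rho> ^ m = C ^ m * l powr (1 - real m * \<beta>)"
      proof -
        have "(l powr (- \<beta>)) ^ m = l powr (- (real m * \<beta>))"
          using l by (simp add: powr_powr mult.commute flip: powr_realpow)
        moreover have "l * l powr (- (real m * \<beta>)) = l powr (1 - real m * \<beta>)"
          using l by (simp add: powr_mult_base)
        ultimately show ?thesis by (simp add: \<rho>_def power_mult_distrib mult.left_commute)
      qed
      moreover have "l * \<rho> = C * l powr (1 - \<beta>)"
        using l by (simp add: \<rho>_def powr_mult_base mult.left_commute)
      ultimately show ?thesis by (metis distrib_left mult.assoc)
    qed
    also have "\<dots> \<le> C ^ m * (B powr (1 - real m * \<beta>) * norm (u m)) + C * (h powr (\<beta> - 1) * E)"
      using C E0 lh False B m by (intro add_mono mult_left_mono mult_right_mono powr_mono2') auto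
    finally have "l * norm (u 0) \<le> C ^ m * (B powr (1 - real m * \<beta>) * norm (u m)) + C * (h powr (\<beta> - 1) * E)" .
    moreover have "0 \<le> B * norm (u 0)" using B by simp
    ultimately show ?thesis by (simp add: mult.assoc)
  qed
  ultimately show ?thesis using e0 by (simp add: E_def algebra_simps)
qed

text \<open>The orbit of \<open>x\<close> is cut off by the bump function at the time scale \<open>t\<close>. With \<open>W i\<close> for the orbit
  weighted by the \<open>i\<close>-th derivative of the rescaled bump, \<open>d/ds W i = W (i + 1) - A (W i)\<close>. This
  equation is sampled on \<open>N = 12 n\<close> points of step size \<open>h = t / (4 n)\<close>, with central differences in
  place of the derivative. On the Fourier side a central difference is multiplication by \<open>\<i>\<eta>\<close> with
  \<open>\<eta> = Im z / h\<close>, which is exactly imaginary, so that the resolvent bound applies to the sampled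
  equation; and \<open>\<bar>\<eta>\<bar> \<ge> 2 / (3 t)\<close> at all nodes, so that only high frequencies occur when \<open>t\<close> is small.
  Frequencies are split at \<open>B = t powr (- 1 / \<beta>)\<close>. The discretisation errors are \<open>O(h)\<close> and enter
  multiplied by \<open>h powr (\<beta> - 1)\<close>; they disappear as \<open>n\<close> tends to infinity.\<close>

lemma short_time_estimate:
  assumes \<beta>: "0 < \<beta>" "\<beta> \<le> 1" and rd: "resolvent_decay \<beta>"
  shows "\<exists>K>0. \<exists>t1>0. \<forall>t x. 0 < t \<longrightarrow> t \<le> t1 \<longrightarrow> x \<in> D \<longrightarrow> A x \<in> D \<longrightarrow>
      norm (A (T (2 * t) x)) \<le> K * t powr (- 1 / \<beta>) * norm x"
proof -
  obtain C r where C: "C > 0" and r: "r \<ge> 1" and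
    bd: "\<And>\<eta> u. u \<in> D \<Longrightarrow> \<bar>\<eta>\<bar> \<ge> r \<Longrightarrow> norm u \<le> C * \<bar>\<eta>\<bar> powr (- \<beta>) * norm (A u + (\<i> * of_real \<eta>) *\<^sub>C u)"
    using rd by (auto simp: resolvent_decay_def)
  obtain M where M: "M \<ge> 1" "\<And>s x. 0 \<le> s \<Longrightarrow> s \<le> 2 \<Longrightarrow> norm (T s x) \<le> M * norm x"
    using T_locally_bounded[of 2] by (metis atLeastAtMost_iff)
  define m where "m = nat \<lceil>1 / \<beta>\<rceil>"
  have m: "m > 0" "real m * \<beta> \<ge> 1"
  proof -
    have "1 / \<beta> > 0" using \<beta> by simp
    then show "m > 0" by (simp add: m_def)
    have "real m \<ge> 1 / \<beta>" unfolding m_def by (rule real_nat_ceiling_ge)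
    then show "real m * \<beta> \<ge> 1" using \<beta> by (simp add: field_simps)
  qed
  obtain \<phi> c where \<phi>': "\<And>i s. i \<le> m \<Longrightarrow> (\<phi> i has_real_derivative \<phi> (Suc i) s) (at s)"
    and \<phi>0: "\<And>i s. s \<notin> {1..2} \<Longrightarrow> \<phi> i s = 0"
    and \<phi>c: "\<And>i s. i \<le> Suc m \<Longrightarrow> \<bar>\<phi> i s\<bar> \<le> c"
    and \<phi>1: "\<And>s. 5/4 \<le> s \<Longrightarrow> s \<le> 7/4 \<Longrightarrow> \<phi> 0 s \<ge> 1"
    by (rule bump_exists[of m]) blast
  have c0: "c \<ge> 1" using \<phi>c[of 0 "3/2"] \<phi>1[of "3/2"] by simp
  define X where "X = max r (C powr (1 / \<beta>))"
  have X: "X > 0" using r by (simp add: X_def)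
  define t1 where "t1 = min 1 (2 / (3 * X))"
  have t1: "t1 > 0" using X by (simp add: t1_def)
  define Q where "Q = 6 * real (m + 3) * (2 + (C ^ m)\<^sup>2)"
  have Q: "Q > 0" by (simp add: Q_def add_pos_nonneg)
  have main: "norm (A (T (2 * t) x)) \<le> (sqrt Q * c * M\<^sup>2) * t powr (- 1 / \<beta>) * norm x"
    if t: "0 < t" "t \<le> t1" and x: "x \<in> D" "A x \<in> D" for t x
  proof -
    have tle: "t \<le> 1" "t \<le> 2 / (3 * X)" using t by (auto simp: t1_def)
    define W where "W = (\<lambda>i x s. ((1 / t) ^ i * \<phi> i (s / t)) *\<^sub>R T s x)"
    have W0: "W i x s = 0" if "s < t \<or> s > 2 * t" for i x s
    proof -
      have "s / t \<notin> {1..2}" using that t by (auto simp: field_simps)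
      then show ?thesis by (simp add: W_def \<phi>0)
    qed
    have W_le: "norm (W i x s) \<le> (1 / t) ^ i * c * M * norm x" if "i \<le> Suc m" for i x s
    proof (cases "s < t \<or> s > 2 * t")
      case True
      then show ?thesis using W0[OF True, of i x] c0 M(1) t by simp
    next
      case False
      then have "norm (W i x s) = (1 / t) ^ i * (\<bar>\<phi> i (s / t)\<bar> * norm (T s x))"
        using t by (simp add: W_def abs_mult)
      also have "\<dots> \<le> (1 / t) ^ i * (c * (M * norm x))"
        using \<phi>c[OF that] M(2)[of s x] c0 False t tle by (intro mult_left_mono mult_mono) auto
      finally show ?thesis by (simp add: mult.assoc)
    qed
    have W': "(W i x has_vector_derivative W (Suc i) x s - W i (A x) s) (at s)"
      if i: "i \<le> m" and x: "x \<in> D" for i x s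
    proof (cases "s < t")
      case True
      have "((\<lambda>_. 0) has_vector_derivative 0) (at s)" by (rule has_vector_derivative_const)
      then have "(W i x has_vector_derivative 0) (at s)"
        by (rule has_vector_derivative_transform_within_open[of _ _ _ "{..<t}"]) (use True W0 in auto)
      then show ?thesis using W0 True by simp
    next
      case False
      then have s: "s > 0" using t by simp
      have "((\<lambda>s. s / t) has_real_derivative 1 / t) (at s)"
        using t by (intro DERIV_cdivide DERIV_ident)
      then have "((\<lambda>s. (1 / t) ^ i * \<phi> i (s / t)) has_real_derivative
          (1 / t) ^ i * (\<phi> (Suc i) (s / t) * (1 / t))) (at s)"
        by (intro DERIV_cmult DERIV_chain2[OF \<phi>'[OF i]])
      then have "((\<lambda>s. (1 / t) ^ i * \<phi> i (s / t)) has_real_derivative (1 / t) ^ Suc i * \<phi> (Suc i) (s / t)) (at s)"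
        by (simp add: mult_ac)
      from has_vector_derivative_scaleR[OF this T_has_derivative[OF x s]]
      show ?thesis by (simp add: W_def)
    qed
    define Wd where "Wd = (\<lambda>i s. W (Suc i) x s - W i (A x) s)"
    have lip: "norm (W i x r - W i x s)
        \<le> ((1 / t) ^ Suc i * c * M * norm x + (1 / t) ^ i * c * M * norm (A x)) * \<bar>r - s\<bar>"
      if i: "i \<le> m" and x: "x \<in> D" for i x r s
    proof -
      have *: "norm (W i x b - W i x a)
        \<le> ((1 / t) ^ Suc i * c * M * norm x + (1 / t) ^ i * c * M * norm (A x)) * (b - a)"
        if ab: "a \<le> b" for a b
      proof (rule mean_value_inequality[OF ab _ W'[OF i x]])
        show "continuous_on {a..b} (W i x)"
          using W'[OF i x] by (intro continuous_at_imp_continuous_on)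
            (auto intro: has_vector_derivative_continuous)
        show "norm (W (Suc i) x s - W i (A x) s)
            \<le> (1 / t) ^ Suc i * c * M * norm x + (1 / t) ^ i * c * M * norm (A x)" for s
          using i by (intro order_trans[OF norm_triangle_ineq4] add_mono W_le) auto
      qed
      show ?thesis
        using *[of r s] *[of s r] by (cases "r \<le> s") (auto simp: norm_minus_commute)
    qed
    define Li where "Li = (\<lambda>i y. (1 / t) ^ Suc i * c * M * norm y + (1 / t) ^ i * c * M * norm (A y))"
    have Li0: "Li i y \<ge> 0" for i y using t c0 M(1) by (simp add: Li_def)
    define L where "L = (\<Sum>i\<le>m. Li i x + Li i (A x))"
    have L: "Li i x + Li j (A x) \<le> 2 * L" if "i \<le> m" "j \<le> m" for i j
    proof -
      have "Li k x + Li k (A x) \<le> L" if "k \<le> m" for k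
        unfolding L_def using that Li0 by (intro member_le_sum[of k]) auto
      from this[OF that(1)] this[OF that(2)] show ?thesis using Li0[of i "A x"] Li0[of j x] by linarith
    qed
    have L0: "L \<ge> 0" unfolding L_def using Li0 by (intro sum_nonneg) auto
    have Wd_lip: "norm (Wd i r - Wd i s) \<le> 2 * L * \<bar>r - s\<bar>" if i: "i < m" for i r s
    proof -
      have "norm (Wd i r - Wd i s) = norm ((W (Suc i) x r - W (Suc i) x s) - (W i (A x) r - W i (A x) s))"
        by (simp add: Wd_def algebra_simps)
      also have "\<dots> \<le> norm (W (Suc i) x r - W (Suc i) x s) + norm (W i (A x) r - W i (A x) s)"
        by (rule norm_triangle_ineq4)
      also have "\<dots> \<le> Li (Suc i) x * \<bar>r - s\<bar> + Li i (A x) * \<bar>r - s\<bar>"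
        unfolding Li_def using i x by (intro add_mono lip) auto
      also have "\<dots> \<le> 2 * L * \<bar>r - s\<bar>"
        using L[of "Suc i" i] i by (simp add: distrib_right[symmetric] mult_right_mono)
      finally show ?thesis .
    qed
    define B where "B = t powr (- 1 / \<beta>)"
    have B: "B > 0" using t by (simp add: B_def)
    have tB: "1 / t \<le> B"
    proof -
      have "t powr (- 1) \<le> t powr (- 1 / \<beta>)" using t tle \<beta> by (intro powr_mono') auto
      then show ?thesis using t by (simp add: B_def powr_minus_divide)
    qed
    have Bm: "B powr (1 - real m * \<beta>) * (1 / t) ^ m = B"
    proof -
      have "B powr (1 - real m * \<beta>) = B * B powr (- (real m * \<beta>))"
        using B by (simp add: powr_mult_base)
      also have "B powr (- (real m * \<beta>)) = t powr real m"
        using \<beta> by (simp add: B_def powr_powr)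
      also have "\<dots> = t ^ m" using t by (simp add: powr_realpow)
      finally show ?thesis using t by (simp add: power_divide)
    qed
    define y where "y = norm (A (T (2 * t) x))"
    define P where "P = (c * M * norm x)\<^sup>2"
    have discrete: "(y / M)\<^sup>2 \<le> Q * B\<^sup>2 * P
        + 6 * real (m + 3) * (((1 + C)\<^sup>2 * real m) * (2 * L)\<^sup>2) * (t / (4 * real n)) powr (2 * \<beta>)"
      if n: "n > 0" for n :: nat
    proof -
      define N where "N = 12 * n"
      define h where "h = t / (4 * real n)"
      have N: "N > 0" "even N" using n by (auto simp: N_def)
      have h: "0 < h" "h \<le> t / 4" "h \<le> 1"
        using t tle n by (auto simp: h_def field_simps)
      have Nh: "real N * h = 3 * t" using n by (simp add: N_def h_def)
      define e where "e = (\<lambda>i k. (W i x (real k * h + h) - W i x (real k * h - h)) /\<^sub>R (2 * h) - Wd i (real k * h))"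
      have e_le: "norm (e i k) \<le> 2 * L * h" if "i < m" for i k
        unfolding e_def
        by (rule central_difference_bound) (use W'[of i x] Wd_lip that x h L0 in \<open>auto simp: Wd_def\<close>)
      have key: "norm (dft N (\<lambda>k. W 0 (A x) (real k * h)) z)
          \<le> B * norm (dft N (\<lambda>k. W 0 x (real k * h)) z) + norm (dft N (\<lambda>k. W 1 x (real k * h)) z)
            + C ^ m * B powr (1 - real m * \<beta>) * norm (dft N (\<lambda>k. W m x (real k * h)) z)
            + (1 + C) * h powr (\<beta> - 1) * (\<Sum>i<m. norm (dft N (e i) z))"
        if z: "cmod z = 1" "\<bar>Im z\<bar> \<ge> 2 / real N" for z
      proof -
        define u where "u = (\<lambda>i. dft N (\<lambda>k. W i x (real k * h)) z)"
        define \<eta> where "\<eta> = Im z / h"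
        have zz: "z * cnj z = 1" using z complex_norm_square[of z] by simp
        have W_D: "W i x s \<in> D" "A (W i x s) = W i (A x) s" for i s
        proof -
          have "W i x s \<in> D \<and> A (W i x s) = W i (A x) s"
          proof (cases "s < t")
            case True
            then show ?thesis using W0 by (simp add: D_zero A_zero)
          next
            case False
            then show ?thesis using t x by (simp add: W_def D_scaleR A_scaleR T_D)
          qed
          then show "W i x s \<in> D" "A (W i x s) = W i (A x) s" by auto
        qed
        have u_D: "u i \<in> D" for i
          unfolding u_def dft_def by (intro D_sum D_scaleC W_D)
        have Au: "A (u i) = dft N (\<lambda>k. W i (A x) (real k * h)) z" for i
          unfolding u_def dft_def by (simp add: A_sum A_scaleC D_scaleC W_D)
        have eq: "A (u i) + (\<i> * of_real \<eta>) *\<^sub>C u i = u (Suc i) + dft N (e i) z" for i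
        proof -
          have fwd: "dft N (\<lambda>k. W i x (real k * h + h)) z = z *\<^sub>C u i"
            using dft_shift[of z "\<lambda>k. W i x (real k * h)" N] z(1) W0 t Nh
            by (simp add: u_def algebra_simps)
          have "dft N (\<lambda>k. W i x (real (Suc k) * h - h)) z = z *\<^sub>C dft N (\<lambda>k. W i x (real k * h - h)) z"
            by (rule dft_shift[OF z(1)]) (use W0 t h Nh in auto)
          then have "u i = z *\<^sub>C dft N (\<lambda>k. W i x (real k * h - h)) z"
            by (simp add: u_def algebra_simps)
          then have bwd: "dft N (\<lambda>k. W i x (real k * h - h)) z = cnj z *\<^sub>C u i"
            by (simp add: scaleC_scaleC zz mult.commute)
          have "dft N (e i) z = (z *\<^sub>C u i - cnj z *\<^sub>C u i) /\<^sub>R (2 * h)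
              - (u (Suc i) - dft N (\<lambda>k. W i (A x) (real k * h)) z)"
            unfolding e_def dft_diff dft_scaleR fwd bwd Wd_def u_def ..
          moreover have "(z *\<^sub>C u i - cnj z *\<^sub>C u i) /\<^sub>R (2 * h) = (\<i> * of_real \<eta>) *\<^sub>C u i"
          proof -
            have "(z *\<^sub>C u i - cnj z *\<^sub>C u i) /\<^sub>R (2 * h) = of_real (inverse (2 * h)) *\<^sub>C ((z - cnj z) *\<^sub>C u i)"
              by (simp only: scaleC_of_real scaleC_diff_left)
            also have "\<dots> = (of_real (inverse (2 * h)) * (z - cnj z)) *\<^sub>C u i"
              by (rule scaleC_scaleC)
            also have "of_real (inverse (2 * h)) * (z - cnj z) = \<i> * of_real \<eta>"
              using h by (simp add: complex_diff_cnj \<eta>_def field_simps)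
            finally show ?thesis .
          qed
          ultimately show ?thesis by (simp add: Au)
        qed
        have \<eta>_X: "\<bar>\<eta>\<bar> \<ge> X"
        proof -
          have "X \<le> 2 / (3 * t)" using tle(2) t(1) X by (simp add: field_simps)
          also have "\<dots> = 2 / real N / h" using Nh by simp
          also have "\<dots> \<le> \<bar>Im z\<bar> / h" by (rule divide_right_mono[OF z(2)]) (use h in simp)
          also have "\<dots> = \<bar>\<eta>\<bar>" using h by (simp add: \<eta>_def abs_divide)
          finally show ?thesis .
        qed
        then have \<eta>_ge: "\<bar>\<eta>\<bar> \<ge> max r (C powr (1 / \<beta>))" by (simp only: X_def)
        have "norm (A (u 0)) \<le> B * norm (u 0) + norm (u 1) + C ^ m * B powr (1 - real m * \<beta>) * norm (u m)
            + (1 + C) * h powr (\<beta> - 1) * (\<Sum>i<m. norm (dft N (e i) z))"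
        proof (rule frequency_estimate[OF C \<beta> m, where \<eta> = \<eta>])
          show "norm (u i) \<le> C * \<bar>\<eta>\<bar> powr (- \<beta>) * norm (A (u i) + (\<i> * of_real \<eta>) *\<^sub>C u i)" for i
            using bd[OF u_D] \<eta>_ge by simp
          show "\<bar>\<eta>\<bar> \<ge> 1" using \<eta>_ge r by simp
          have "\<bar>\<eta>\<bar> powr (- \<beta>) \<le> (C powr (1 / \<beta>)) powr (- \<beta>)"
            using \<eta>_ge C \<beta> by (intro powr_mono2') auto
          also have "\<dots> = 1 / C" using C \<beta> by (simp add: powr_powr powr_minus_divide)
          finally show "C * \<bar>\<eta>\<bar> powr (- \<beta>) \<le> 1" using C by (simp add: field_simps)
          show "\<bar>\<eta>\<bar> \<le> 1 / h"
            using abs_Im_le_cmod[of z] z(1) h by (simp add: \<eta>_def divide_right_mono)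
        qed (use eq h B in auto)
        then show ?thesis by (simp only: Au) (simp only: u_def)
      qed
      \<comment> \<open>the sequences and coefficients on the right-hand side of \<open>key\<close>; from index \<open>3\<close> on, the errors\<close>
      define b where "b = (\<lambda>(i::nat) k. if i = 0 then W 0 x (real k * h) else if i = 1 then W 1 x (real k * h)
          else if i = 2 then W m x (real k * h) else e (i - 3) k)"
      define co where "co = (\<lambda>i::nat. if i = 0 then B else if i = 1 then 1
          else if i = 2 then C ^ m * B powr (1 - real m * \<beta>) else (1 + C) * h powr (\<beta> - 1))"
      have split: "(\<Sum>i<m + 3. F i) = F 0 + F 1 + F 2 + (\<Sum>i<m. F (i + 3))" for F :: "nat \<Rightarrow> real"
        by (simp add: eval_nat_numeral sum.lessThan_Suc_shift del: sum.lessThan_Suc)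
      have "(\<Sum>k<N. (norm (W 0 (A x) (real k * h)))\<^sup>2)
          \<le> real (card {..<m + 3}) * (\<Sum>i<m + 3. (co i)\<^sup>2 * (\<Sum>k<N. (norm (b i k))\<^sup>2))"
      proof (rule dft_comparison)
        fix j assume "j < N"
        show "norm (dft N (\<lambda>k. W 0 (A x) (real k * h)) (node N j))
            \<le> (\<Sum>i<m + 3. co i * norm (dft N (b i) (node N j)))"
          unfolding split using key[OF norm_node abs_Im_node[OF N(2,1)], of j]
          by (simp add: b_def co_def sum_distrib_left)
      qed simp
      also have "\<dots> \<le> real (m + 3) * (2 * (real N * (B\<^sup>2 * P)) + real N * ((C ^ m)\<^sup>2 * (B\<^sup>2 * P))
          + real m * (((1 + C) * h powr (\<beta> - 1))\<^sup>2 * (real N * (2 * L * h)\<^sup>2)))"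
      proof -
        have mean: "(\<Sum>k<N. (norm (a k))\<^sup>2) \<le> real N * d\<^sup>2" if "\<And>k. norm (a k) \<le> d" for a :: "nat \<Rightarrow> 'a" and d
        proof -
          have "(\<Sum>k<N. (norm (a k))\<^sup>2) \<le> (\<Sum>k<N. d\<^sup>2)" by (intro sum_mono power_mono that) auto
          then show ?thesis by simp
        qed
        have "(co 0)\<^sup>2 * (\<Sum>k<N. (norm (b 0 k))\<^sup>2) \<le> B\<^sup>2 * (real N * P)"
          using mean[of "b 0" "c * M * norm x"] W_le[of 0 x]
          by (simp add: co_def b_def P_def mult_left_mono)
        moreover have "(co 1)\<^sup>2 * (\<Sum>k<N. (norm (b 1 k))\<^sup>2) \<le> real N * (B\<^sup>2 * P)"
        proof -
          have "norm (b 1 k) \<le> B * (c * M * norm x)" for k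
          proof -
            have "norm (b 1 k) \<le> 1 / t * (c * M * norm x)" using W_le[of 1 x] by (simp add: b_def mult.assoc)
            also have "\<dots> \<le> B * (c * M * norm x)"
              using tB c0 M(1) by (intro mult_right_mono) auto
            finally show ?thesis .
          qed
          from mean[OF this] show ?thesis by (simp add: co_def P_def power_mult_distrib)
        qed
        moreover have "(co 2)\<^sup>2 * (\<Sum>k<N. (norm (b 2 k))\<^sup>2) \<le> real N * ((C ^ m)\<^sup>2 * (B\<^sup>2 * P))"
        proof -
          have "(co 2)\<^sup>2 * (\<Sum>k<N. (norm (b 2 k))\<^sup>2)
              \<le> (C ^ m * B powr (1 - real m * \<beta>))\<^sup>2 * (real N * ((1 / t) ^ m * (c * M * norm x))\<^sup>2)"
            using mean[of "b 2" "(1 / t) ^ m * (c * M * norm x)"] W_le[of m x]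
            by (simp add: co_def b_def mult_left_mono mult.assoc)
          also have "\<dots> = real N * ((C ^ m)\<^sup>2 * ((B powr (1 - real m * \<beta>) * (1 / t) ^ m)\<^sup>2 * P))"
            by (simp add: power_mult_distrib P_def mult_ac)
          finally show ?thesis unfolding Bm .
        qed
        moreover have "(\<Sum>i<m. (co (i + 3))\<^sup>2 * (\<Sum>k<N. (norm (b (i + 3) k))\<^sup>2))
            \<le> (\<Sum>i<m. ((1 + C) * h powr (\<beta> - 1))\<^sup>2 * (real N * (2 * L * h)\<^sup>2))"
          using e_le by (intro sum_mono) (auto simp: co_def b_def intro!: mult_left_mono mean)
        ultimately have "(\<Sum>i<m + 3. (co i)\<^sup>2 * (\<Sum>k<N. (norm (b i k))\<^sup>2))
          \<le> 2 * (real N * (B\<^sup>2 * P)) + real N * ((C ^ m)\<^sup>2 * (B\<^sup>2 * P))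
          + real m * (((1 + C) * h powr (\<beta> - 1))\<^sup>2 * (real N * (2 * L * h)\<^sup>2))"
          unfolding split by (simp add: mult.left_commute)
        then show ?thesis by (simp add: mult_left_mono)
      qed
      also have "\<dots> = 2 * real n * (Q * B\<^sup>2 * P
          + 6 * real (m + 3) * (((1 + C)\<^sup>2 * real m) * (2 * L)\<^sup>2) * h powr (2 * \<beta>))"
      proof -
        have "(h powr (\<beta> - 1))\<^sup>2 * h\<^sup>2 = h powr (2 * \<beta>)"
          using h by (simp add: power2_eq_square powr_diff flip: powr_add)
        moreover have "((1 + C) * h powr (\<beta> - 1))\<^sup>2 * (real N * (2 * L * h)\<^sup>2)
            = real N * ((1 + C)\<^sup>2 * (2 * L)\<^sup>2 * ((h powr (\<beta> - 1))\<^sup>2 * h\<^sup>2))"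
          by (simp only: power_mult_distrib mult_ac)
        ultimately have "((1 + C) * h powr (\<beta> - 1))\<^sup>2 * (real N * (2 * L * h)\<^sup>2)
            = real N * ((1 + C)\<^sup>2 * (2 * L)\<^sup>2 * h powr (2 * \<beta>))" by (simp only:)
        then show ?thesis by (simp only: Q_def N_def of_nat_mult of_nat_numeral) (simp add: algebra_simps)
      qed
      finally have upper: "(\<Sum>k<N. (norm (W 0 (A x) (real k * h)))\<^sup>2) \<le> 2 * real n * (Q * B\<^sup>2 * P
          + 6 * real (m + 3) * (((1 + C)\<^sup>2 * real m) * (2 * L)\<^sup>2) * h powr (2 * \<beta>))" .
      \<comment> \<open>The indices from \<open>5 n\<close> to \<open>7 n\<close> are the times in \<open>{5 / 4 * t..7 / 4 * t}\<close>, where the bump is at least \<open>1\<close>.\<close>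
      have lower: "(y / M)\<^sup>2 \<le> (norm (W 0 (A x) (real k * h)))\<^sup>2" if k: "k \<in> {5 * n..<7 * n}" for k
      proof (rule power_mono)
        define s where "s = real k * h"
        have st: "s / t = real k / (4 * real n)" using t n by (simp add: s_def h_def)
        have k': "5 * real n \<le> real k" "real k \<le> 7 * real n" using k by auto
        have st1: "5/4 \<le> s / t" "s / t \<le> 7/4" unfolding st using k' n by (simp_all add: field_simps)
        have s: "0 \<le> s" "s \<le> 2 * t" "2 * t - s \<le> 2"
          using st1 t tle by (auto simp: field_simps)
        have "y = norm (T (2 * t - s) (T s (A x)))"
          using s t x by (simp add: y_def T_D flip: T_add)
        also have "\<dots> \<le> M * norm (T s (A x))" using M(2) s by simp
        finally have "y / M \<le> norm (T s (A x))" using M(1) by (simp add: field_simps)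
        also have "\<dots> \<le> \<bar>\<phi> 0 (s / t)\<bar> * norm (T s (A x))"
          using \<phi>1[OF st1] mult_right_mono[of 1 "\<bar>\<phi> 0 (s / t)\<bar>" "norm (T s (A x))"] by simp
        also have "\<dots> = norm (W 0 (A x) s)" by (simp add: W_def)
        finally show "y / M \<le> norm (W 0 (A x) (real k * h))" by (simp add: s_def)
        show "0 \<le> y / M" using M(1) by (simp add: y_def)
      qed
      have "2 * real n * (y / M)\<^sup>2 = (\<Sum>k\<in>{5 * n..<7 * n}. (y / M)\<^sup>2)" by simp
      also have "\<dots> \<le> (\<Sum>k\<in>{5 * n..<7 * n}. (norm (W 0 (A x) (real k * h)))\<^sup>2)"
        by (intro sum_mono lower)
      also have "\<dots> \<le> (\<Sum>k<N. (norm (W 0 (A x) (real k * h)))\<^sup>2)"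
        by (rule sum_mono2) (auto simp: N_def)
      finally have "2 * real n * (y / M)\<^sup>2 \<le> 2 * real n * (Q * B\<^sup>2 * P
          + 6 * real (m + 3) * (((1 + C)\<^sup>2 * real m) * (2 * L)\<^sup>2) * h powr (2 * \<beta>))"
        using upper by linarith
      then show ?thesis unfolding h_def by (rule mult_left_le_imp_le) (use n in simp)
    qed
    have "(\<lambda>n. t / 4 * inverse (real (Suc n))) \<longlonglongrightarrow> t / 4 * 0"
      by (intro tendsto_mult tendsto_const LIMSEQ_inverse_real_of_nat)
    moreover have "t / 4 * inverse (real (Suc n)) = t / (4 * real (Suc n))" for n
      by (simp add: field_simps)
    ultimately have "(\<lambda>n. t / (4 * real (Suc n))) \<longlonglongrightarrow> 0"
      by (simp only: mult_zero_right)
    then have "(\<lambda>n. (t / (4 * real (Suc n))) powr (2 * \<beta>)) \<longlonglongrightarrow> 0"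
      by (rule tendsto_zero_powrI[where b = "2 * \<beta>"]) (use \<beta> t in auto)
    then have "(\<lambda>n. Q * B\<^sup>2 * P + 6 * real (m + 3) * (((1 + C)\<^sup>2 * real m) * (2 * L)\<^sup>2)
        * (t / (4 * real (Suc n))) powr (2 * \<beta>)) \<longlonglongrightarrow>
        Q * B\<^sup>2 * P + 6 * real (m + 3) * (((1 + C)\<^sup>2 * real m) * (2 * L)\<^sup>2) * 0"
      by (intro tendsto_intros)
    then have "(y / M)\<^sup>2 \<le> Q * B\<^sup>2 * P + 6 * real (m + 3) * (((1 + C)\<^sup>2 * real m) * (2 * L)\<^sup>2) * 0"
      by (rule LIMSEQ_le_const) (use discrete in blast)
    also have "\<dots> = (sqrt Q * B * (c * M * norm x))\<^sup>2"
      using Q by (simp add: P_def power_mult_distrib)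
    finally have "y / M \<le> sqrt Q * B * (c * M * norm x)"
      by (rule power2_le_imp_le) (use Q B c0 M in auto)
    moreover have "M > 0" using M(1) by simp
    ultimately have "y \<le> sqrt Q * B * (c * M * norm x) * M" by (simp only: pos_divide_le_eq)
    then show ?thesis by (simp only: y_def B_def power2_eq_square mult_ac)
  qed
  have "sqrt Q * c * M\<^sup>2 > 0" using Q c0 M(1) by simp
  then show ?thesis using main t1 by blast
qed

end

context cayley_setting
begin

text \<open>The short-time estimate extends from the dense set of all \<open>x\<close> in the domain
  with \<open>A x\<close> in the domain to all \<open>x\<close>,
  because \<open>A\<close> is closed; this also shows that \<open>T t\<close> maps into the domain, and so that orbits are
  differentiable.\<close>

lemma crandall_pazy_of_resolvent_decay:
  assumes \<beta>: "0 < \<beta>" "\<beta> \<le> 1" and rd: "resolvent_decay \<beta>"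
  shows "crandall_pazy T A \<beta>"
proof -
  obtain K t1 where K: "K > 0" and t1: "t1 > 0" and
    est: "\<And>t x. 0 < t \<Longrightarrow> t \<le> t1 \<Longrightarrow> x \<in> D \<Longrightarrow> A x \<in> D \<Longrightarrow>
      norm (A (T (2 * t) x)) \<le> K * t powr (- 1 / \<beta>) * norm x"
    using short_time_estimate[OF \<beta> rd] by blast
  define K' where "K' = K * 2 powr (1 / \<beta>)"
  have small: "T t x \<in> D \<and> norm (A (T t x)) \<le> K' * t powr (- 1 / \<beta>) * norm x"
    if t: "0 < t" "t \<le> 2 * t1" for t x
  proof -
    define k where "k = K' * t powr (- 1 / \<beta>)"
    have k: "k \<ge> 0" using K by (simp add: k_def K'_def)
    have le: "norm (A (T t z)) \<le> k * norm z" if "z \<in> D" "A z \<in> D" for z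
    proof -
      have "norm (A (T (2 * (t / 2)) z)) \<le> K * (t / 2) powr (- 1 / \<beta>) * norm z"
        using t that by (intro est) auto
      also have "K * (t / 2) powr (- 1 / \<beta>) = k"
        using t by (simp add: k_def K'_def powr_divide powr_minus_divide)
      finally show ?thesis by simp
    qed
    have "x \<in> closure {z \<in> D. A z \<in> D}" by (simp add: D2_dense)
    then obtain z where z: "\<And>n. z n \<in> D" "\<And>n. A (z n) \<in> D" and lim: "z \<longlonglongrightarrow> x"
      by (auto simp: closure_sequential)
    have diff: "norm (A (T t (z i)) - A (T t (z j))) \<le> k * norm (z i - z j)" for i j
      using le[of "z i - z j"] z t by (simp add: T_diff A_diff D_diff T_D)
    have "Cauchy (\<lambda>n. A (T t (z n)))"
    proof (rule CauchyI)
      fix e :: real assume e: "e > 0"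
      have "Cauchy z" using lim by (rule LIMSEQ_imp_Cauchy)
      then obtain N where N: "\<And>i j. i \<ge> N \<Longrightarrow> j \<ge> N \<Longrightarrow> norm (z i - z j) < e / (k + 1)"
        using e k by (metis CauchyD add_nonneg_pos divide_pos_pos zero_less_one)
      have "norm (A (T t (z i)) - A (T t (z j))) < e" if "i \<ge> N" "j \<ge> N" for i j
      proof -
        have "norm (A (T t (z i)) - A (T t (z j))) \<le> (k + 1) * norm (z i - z j)"
          by (rule order_trans[OF diff mult_right_mono]) auto
        also have "\<dots> < (k + 1) * (e / (k + 1))"
          using N[OF that] k by (intro mult_strict_left_mono) auto
        finally show ?thesis using k by simp
      qed
      then show "\<exists>N. \<forall>i\<ge>N. \<forall>j\<ge>N. norm (A (T t (z i)) - A (T t (z j))) < e" by blast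
    qed
    then obtain y where y: "(\<lambda>n. A (T t (z n))) \<longlonglongrightarrow> y"
      using Cauchy_convergent convergent_def by blast
    have "(\<lambda>n. T t (z n)) \<longlonglongrightarrow> T t x"
      using t by (intro bounded_linear.tendsto[OF T_bounded_linear] lim) auto
    from A_closed[OF _ this y] have *: "T t x \<in> D" "A (T t x) = y"
      using T_D z t by auto
    have "norm y \<le> k * norm x"
    proof (rule tendsto_le[OF _ tendsto_mult[OF tendsto_const tendsto_norm[OF lim]] tendsto_norm[OF y]])
      show "eventually (\<lambda>n. norm (A (T t (z n))) \<le> k * norm (z n)) sequentially"
        using le z by simp
    qed simp
    with * show ?thesis by (simp add: k_def)
  qed
  have "(\<lambda>s. T s x) differentiable (at t)" if t: "t > 0" for t x
  proof -
    define \<tau> where "\<tau> = min t t1 / 2"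
    have \<tau>: "0 < \<tau>" "\<tau> < t" "\<tau> \<le> 2 * t1" using t t1 by (auto simp: \<tau>_def)
    have "(\<lambda>s. T s (T \<tau> x)) differentiable (at (t - \<tau>))"
      by (rule differentiableI_vector, rule T_has_derivative) (use small \<tau> in auto)
    then have "((\<lambda>s. T s (T \<tau> x)) \<circ> (\<lambda>s. s - \<tau>)) differentiable (at t)"
      by (intro differentiable_chain_at) auto
    then show ?thesis
    proof (rule differentiable_transform_within[where d = "t - \<tau>"])
      fix s assume "dist s t < t - \<tau>"
      then have "s > \<tau>" by (auto simp: dist_real_def abs_less_iff)
      then show "((\<lambda>s. T s (T \<tau> x)) \<circ> (\<lambda>s. s - \<tau>)) s = T s x"
        using \<tau> by (simp flip: T_add)
    qed (use \<tau> in auto)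
  qed
  moreover have "(\<lambda>t. onorm (\<lambda>x. A (T t x))) \<in> O[at_right 0](\<lambda>t. t powr (- 1 / \<beta>))"
  proof (rule bigoI[of _ K'])
    have "norm (onorm (\<lambda>x. A (T t x))) \<le> K' * norm (t powr (- 1 / \<beta>))" if "0 < t" "t < t1" for t
    proof -
      have s: "T t x \<in> D" "norm (A (T t x)) \<le> K' * t powr (- 1 / \<beta>) * norm x" for x
        using small[of t x] that by auto
      have "onorm (\<lambda>x. A (T t x)) \<le> K' * t powr (- 1 / \<beta>)"
        using s(2) K by (intro onorm_bound) (auto simp: K'_def)
      moreover have "onorm (\<lambda>x. A (T t x)) \<ge> 0"
        using that s(1) by (intro onorm_pos_le A_T_bounded_linear) auto
      ultimately show ?thesis by simp
    qed
    then show "eventually (\<lambda>t. norm (onorm (\<lambda>x. A (T t x))) \<le> K' * norm (t powr (- 1 / \<beta>))) (at_right 0)"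
      using t1 by (auto simp: eventually_at_right_field)
  qed
  ultimately show ?thesis by (simp add: crandall_pazy_def)
qed

end

section \<open>The equivalence\<close>

context cayley_setting
begin

lemma I_minus_V: "x - V x = (2 * w) *\<^sub>R S x"
  by (simp add: V_eq)

lemmas V_power_bounded_linear = bounded_linear_funpow[OF V_bounded_linear]

lemma V_power_S_bounded_linear: "bounded_linear (\<lambda>x. (V ^^ n) (S x))"
  by (rule bounded_linear_compose[OF V_power_bounded_linear S_bounded_linear])

lemma crandall_pazy_iff_resolvent_decay:
  assumes "0 < \<beta>" "\<beta> \<le> 1"
  shows "crandall_pazy T A \<beta> \<longleftrightarrow> resolvent_decay \<beta>"
  using crandall_pazy_of_resolvent_decay resolvent_decay_of_crandall_pazy assms by blast

lemma resolvent_decay_iff_cayley_decay: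
  assumes \<beta>: "0 < \<beta>" "\<beta> \<le> 1"
    and spec: "\<And>\<eta>. \<i> * of_real \<eta> \<in> resolvent_set D A"
    and M: "M \<ge> 1" "\<And>n x. norm ((V ^^ n) x) \<le> M * norm x"
  shows "resolvent_decay \<beta> \<longleftrightarrow>
    (\<lambda>n::nat. onorm (\<lambda>x. (V ^^ n) (S x))) \<in> O(\<lambda>n. real n powr (- 1 / (2 - \<beta>)))"
    (is "_ \<longleftrightarrow> ?decay")
proof
  interpret pb: power_bounded V M
    by (rule power_bounded.intro) (use V_bounded_linear V_scaleC M in auto)
  have VS: "(V ^^ n) (x - V x) = (2 * w) *\<^sub>R (V ^^ n) (S x)" for n x
    unfolding I_minus_V by (rule linear_scale[OF bounded_linear.linear[OF V_power_bounded_linear]])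
  {
    assume "resolvent_decay \<beta>"
    from cayley_resolvent_bound[OF this \<beta> spec] obtain C where C: "C \<ge> 0" and
      bd: "\<And>z x. cmod z = 1 \<Longrightarrow> z \<noteq> 1 \<Longrightarrow>
        norm x \<le> C * cmod (1 - z) powr (- (2 - \<beta>)) * norm (z *\<^sub>C x - V x)" by blast
    define K where "K = 4 * M\<^sup>2 * (C + 2) / (2 * w)"
    have "onorm (\<lambda>x. (V ^^ n) (S x)) \<le> K * real n powr (- 1 / (2 - \<beta>))" if "n > 0" for n
    proof (rule onorm_bound)
      show "0 \<le> K * real n powr (- 1 / (2 - \<beta>))" using C w_pos by (simp add: K_def)
      fix x
      have "(2 * w) * norm ((V ^^ n) (S x)) \<le> 4 * M\<^sup>2 * (C + 2) * real n powr (- 1 / (2 - \<beta>)) * norm x"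
        using pb.decay_of_resolvent_bound[OF _ C bd that, of x] \<beta> w_pos by (simp add: VS)
      then show "norm ((V ^^ n) (S x)) \<le> K * real n powr (- 1 / (2 - \<beta>)) * norm x"
        using w_pos by (simp add: K_def field_simps)
    qed
    then show ?decay
      using onorm_pos_le[OF V_power_S_bounded_linear]
      by (intro bigoI[of _ K]) (auto intro!: eventually_sequentiallyI[of 1])
  }
  {
    assume ?decay
    then obtain C where C: "C > 0" and "eventually (\<lambda>n. norm (onorm (\<lambda>x. (V ^^ n) (S x)))
        \<le> C * norm (real n powr (- 1 / (2 - \<beta>)))) sequentially"
      by (elim landau_o.bigE)
    then obtain n0 where n0: "\<And>n. n \<ge> n0 \<Longrightarrow> norm (onorm (\<lambda>x. (V ^^ n) (S x)))
        \<le> C * norm (real n powr (- 1 / (2 - \<beta>)))"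
      by (auto simp: eventually_sequentially)
    have dec: "norm ((V ^^ n) (x - V x)) \<le> (2 * w * C) * real n powr (- 1 / (2 - \<beta>)) * norm x"
      if n: "n \<ge> Suc n0" for n x
    proof -
      have "norm ((V ^^ n) (S x)) \<le> onorm (\<lambda>x. (V ^^ n) (S x)) * norm x"
        by (rule onorm[OF V_power_S_bounded_linear])
      also have "\<dots> \<le> C * real n powr (- 1 / (2 - \<beta>)) * norm x"
        using n0[of n] n by (intro mult_right_mono) auto
      finally have "2 * w * norm ((V ^^ n) (S x)) \<le> 2 * w * (C * real n powr (- 1 / (2 - \<beta>)) * norm x)"
        using w_pos by (intro mult_left_mono) auto
      then show ?thesis using w_pos by (simp add: VS mult.assoc)
    qed
    from \<beta> C w_pos obtain K \<delta> where "K \<ge> 0" "\<delta> > 0" and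
      "\<And>z x. cmod z = 1 \<Longrightarrow> z \<noteq> 1 \<Longrightarrow> cmod (1 - z) \<le> \<delta> \<Longrightarrow>
        norm x \<le> K * cmod (1 - z) powr (- (2 - \<beta>)) * norm (z *\<^sub>C x - V x)"
      using pb.resolvent_bound_of_decay[of "2 - \<beta>" "2 * w * C" "Suc n0"] dec by auto
    then show "resolvent_decay \<beta>" using \<beta> by (intro resolvent_decay_of_cayley)
  }
qed

end

theorem theorem4p9:
  fixes T :: "real \<Rightarrow> 'a::complex_hilbert \<Rightarrow> 'a"
    and D :: "'a set" and A :: "'a \<Rightarrow> 'a" and \<omega> \<beta> :: real
  assumes "C0_semigroup T"
    and "is_generator T D (\<lambda>x. - A x)"
    and "spectrum D A \<inter> {z. Re z = 0} = {}"
    and "\<omega> > 0" and "complex_of_real \<omega> \<in> resolvent_set D (\<lambda>x. - A x)"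
    and "bdd_above (range (\<lambda>n. onorm (cayley D A \<omega> ^^ n)))"
    and "0 < \<beta>" and "\<beta> \<le> 1"
  shows "crandall_pazy T A \<beta> \<longleftrightarrow>
    (\<lambda>n::nat. onorm (\<lambda>x. (cayley D A \<omega> ^^ n) (shift_inverse D A \<omega> x)))
      \<in> O(\<lambda>n. real n powr (- 1 / (2 - \<beta>)))"
proof -
  interpret cayley_setting T D A \<omega>
    by unfold_locales (use assms in auto)
  have spec: "\<i> * complex_of_real \<eta> \<in> resolvent_set D A" for \<eta>
    using assms(3) by (auto simp: spectrum_def)
  obtain M0 where M0: "\<And>n. onorm (V ^^ n) \<le> M0"
    using assms(6) by (auto simp: bdd_above_def)
  have M: "norm ((V ^^ n) x) \<le> max 1 M0 * norm x" for n x
  proof -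
    have "norm ((V ^^ n) x) \<le> onorm (V ^^ n) * norm x" by (rule onorm[OF V_power_bounded_linear])
    also have "\<dots> \<le> max 1 M0 * norm x" using M0[of n] by (intro mult_right_mono) auto
    finally show ?thesis .
  qed
  show ?thesis
    using crandall_pazy_iff_resolvent_decay resolvent_decay_iff_cayley_decay[OF _ _ spec _ M] assms(7,8)
    by simp
qed

end
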